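(* Let $k$ be an algebraically closed field, let $A$ be a connected monomial $k$-algebra and let $B$ be a monomial subalgebra of $A$ such that $Q_B$ is a subquiver of $Q_A$. Then there is a group isomorphism $$\pi_1(Q_A,I_A)/N_B\cong\pi_1(Q_{A|B}).$$
   Context: A monomial algebra is $A=kQ_A/I_A$ with $Q_A$ a finite quiver and $I_A$ an admissible ideal generated by paths; $B=kQ_B/I_B$ is monomial, with $Q_B$ a subquiver of $Q_A$ having the same vertices, the inclusion $B\subseteq A$ being induced by the inclusion of quivers. A walk in a quiver $Q$ is a path in the quiver obtained from $Q$ by adding a formal inverse $\alpha^{-1}$ to each arrow $\alpha$ (composition right to left). For a vertex $*$, $\pi_1(Q_A,I_A)=\pi_1(Q_A,I_A,* )$ is the group of walks from $*$ to $*$ modulo the concatenation-compatible equivalence relation generated by $\alpha^{-1}\alpha\sim e_{s(\alpha)}$, $\alpha\alpha^{-1}\sim e_{t(\alpha)}$ and $u\sim v$ if the paths $u,v$ occur with nonzero coefficients in a common minimal relation in $I_A$ (a relation no proper subsum of which lies in $I_A$); since $I_A$ is monomial, the last condition imposes nothing. For a quiver $Q$ without relations, $\pi_1(Q)$ is the same group with only the first two types of relations. $N_B$ is the (normal) subgroup of $\pi_1(Q_A,I_A,* )$ generated by all $[v^{-1}(u')^{-1}uv]$ with $u,u'$ walks in $Q_B$ having the same source and the same target and $v$ a walk in $Q_A$ from $*$ to that source. Extended maximal tree: choose a maximal tree in each connected component of $Q_B$, and extend the resulting maximal forest of $Q_B$ to a maximal tree $T$ of $Q_A$. The quiver $Q_{A|B,T}$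 has vertex set $(Q_A)_0$ and arrow set $((Q_A)_1\setminus(Q_B)_1)\cup T$. Up to isomorphism $\pi_1(Q_{A|B,T})$ does not depend on $T$, and is denoted $\pi_1(Q_{A|B})$. *)

theory Defs
  imports
    "HOL-Algebra.QuotRing"
    "HOL-Algebra.Ideal_Product"
    "HOL-Algebra.Generated_Groups"
    "HOL-Library.Poly_Mapping"
    "HOL-Computational_Algebra.Polynomial"
    "Graph_Theory.Digraph_Component"
begin

section \<open>Path algebras\<close>

text \<open>
  A quiver is a digraph of \<^theory>\<open>Graph_Theory.Digraph\<close> (loops and parallel arrows are allowed).
  A path is a triple \<open>(x, p, y)\<close>: source, list of arrows in the order in which they are traversed,
  target; \<open>(x, [], x)\<close> is the trivial path \<open>e\<^sub>x\<close>. Since paths compose from right to left, the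
  product \<open>u v\<close> first runs through \<open>v\<close>, so that arrow lists are concatenated in the opposite order.
\<close>

type_synonym ('v, 'a) qpath = "'v \<times> 'a list \<times> 'v"

definition paths :: "('v, 'a) pre_digraph \<Rightarrow> ('v, 'a) qpath set" where
  "paths Q = {(x, p, y). pre_digraph.awalk Q x p y}"

definition basis_mult ::
    "('v, 'a) qpath \<Rightarrow> ('v, 'a) qpath \<Rightarrow> 'k::field \<Rightarrow> ('v, 'a) qpath \<Rightarrow>\<^sub>0 'k" where
  "basis_mult u v c =
     (case (u, v) of ((y, p, z), (x, q, y')) \<Rightarrow>
        if y = y' then Poly_Mapping.single (x, q @ p, z) c else 0)"

definition path_algebra :: "('v, 'a) pre_digraph \<Rightarrow> (('v, 'a) qpath \<Rightarrow>\<^sub>0 'k::field) ring" where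
  "path_algebra Q =
     \<lparr>carrier = {f. Poly_Mapping.keys f \<subseteq> paths Q},
      monoid.mult = (\<lambda>f g. \<Sum>u\<in>Poly_Mapping.keys f. \<Sum>v\<in>Poly_Mapping.keys g.
                basis_mult u v (Poly_Mapping.lookup f u * Poly_Mapping.lookup g v)),
      one = (\<Sum>x\<in>verts Q. Poly_Mapping.single (x, [], x) 1),
      zero = 0,
      add = (+)\<rparr>"

definition arrow_ideal :: "('v, 'a) pre_digraph \<Rightarrow> (('v, 'a) qpath \<Rightarrow>\<^sub>0 'k::field) set" where
  "arrow_ideal Q =
     genideal (path_algebra Q) ((\<lambda>a. Poly_Mapping.single (tail Q a, [a], head Q a) 1) ` arcs Q)"

definition ideal_power :: "('r, 'm) ring_scheme \<Rightarrow> 'r set \<Rightarrow> nat \<Rightarrow> 'r set" where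
  "ideal_power R J n = ((\<lambda>K. ideal_prod R K J) ^^ n) (carrier R)"

text \<open>
  \<^const>\<open>ideal\<close> means two-sided ideal. The path algebra of a finite quiver is recorded as a ring only:
  it contains \<open>k\<close> as the multiples of its unit, so that two-sided ideals are automatically subspaces.
\<close>

definition admissible_ideal ::
    "('v, 'a) pre_digraph \<Rightarrow> (('v, 'a) qpath \<Rightarrow>\<^sub>0 'k::field) set \<Rightarrow> bool" where
  "admissible_ideal Q I \<longleftrightarrow>
     ideal I (path_algebra Q) \<and>
     I \<subseteq> ideal_power (path_algebra Q) (arrow_ideal Q) 2 \<and>
     (\<exists>m\<ge>2. ideal_power (path_algebra Q) (arrow_ideal Q) m \<subseteq> I)"

definition monomial_presentation ::
    "('v, 'a) pre_digraph \<Rightarrow> (('v, 'a) qpath \<Rightarrow>\<^sub>0 'k::field) set \<Rightarrow> bool" where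
  "monomial_presentation Q I \<longleftrightarrow>
     fin_digraph Q \<and> admissible_ideal Q I \<and>
     (\<exists>P \<subseteq> paths Q. I = genideal (path_algebra Q) ((\<lambda>p. Poly_Mapping.single p 1) ` P))"

abbreviation bound_quiver_algebra ::
    "('v, 'a) pre_digraph \<Rightarrow> (('v, 'a) qpath \<Rightarrow>\<^sub>0 'k::field) set \<Rightarrow> (('v, 'a) qpath \<Rightarrow>\<^sub>0 'k) set ring" where
  "bound_quiver_algebra Q I \<equiv> path_algebra Q Quot I"

text \<open>
  A connected algebra is a nonzero one that is not a direct product of two nonzero algebras,
  that is, not the direct sum of two nonzero two-sided ideals.
\<close>

definition connected_algebra :: "('r, 'm) ring_scheme \<Rightarrow> bool" where
  "connected_algebra R \<longleftrightarrow>
     carrier R \<noteq> {\<zero>\<^bsub>R\<^esub>} \<and>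
     (\<forall>J K. ideal J R \<and> ideal K R \<and> J <+>\<^bsub>R\<^esub> K = carrier R \<and> J \<inter> K = {\<zero>\<^bsub>R\<^esub>} \<longrightarrow>
        J = {\<zero>\<^bsub>R\<^esub>} \<or> K = {\<zero>\<^bsub>R\<^esub>})"

text \<open>
  \<open>B = kQ\<^sub>B/I\<^sub>B\<close> is a subalgebra of \<open>A = kQ\<^sub>A/I\<^sub>A\<close> with the inclusion induced by that of the quivers:
  sending the class of an element of \<open>kQ\<^sub>B\<close> to its class in \<open>A\<close> is a well-defined injective
  homomorphism. It preserves units because the quivers have the same vertices, and hence is
  \<open>k\<close>-linear.
\<close>

definition induced_subalgebra ::
    "('v, 'a) pre_digraph \<Rightarrow> (('v, 'a) qpath \<Rightarrow>\<^sub>0 'k::field) set \<Rightarrow>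
     ('v, 'a) pre_digraph \<Rightarrow> (('v, 'a) qpath \<Rightarrow>\<^sub>0 'k) set \<Rightarrow> bool" where
  "induced_subalgebra QB IB QA IA \<longleftrightarrow>
     spanning QB QA \<and>
     (\<exists>\<phi> \<in> ring_hom (bound_quiver_algebra QB IB) (bound_quiver_algebra QA IA).
        inj_on \<phi> (carrier (bound_quiver_algebra QB IB)) \<and>
        (\<forall>f \<in> carrier (path_algebra QB).
           \<phi> (IB +>\<^bsub>path_algebra QB\<^esub> f) = IA +>\<^bsub>path_algebra QA\<^esub> f))"


section \<open>Walks and the fundamental group\<close>

text \<open>
  \<open>(a, True)\<close> is the arrow \<open>a\<close> itself and \<open>(a, False)\<close> its formal inverse. A walk is a list of such
  steps, again in the order in which they are traversed.
\<close>

definition double_quiver :: "('v, 'a) pre_digraph \<Rightarrow> ('v, 'a \<times> bool) pre_digraph" where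
  "double_quiver Q =
     \<lparr>verts = verts Q, arcs = arcs Q \<times> UNIV,
      tail = (\<lambda>(a, d). if d then tail Q a else head Q a),
      head = (\<lambda>(a, d). if d then head Q a else tail Q a)\<rparr>"

abbreviation walk ::
    "('v, 'a) pre_digraph \<Rightarrow> 'v \<Rightarrow> ('a \<times> bool) list \<Rightarrow> 'v \<Rightarrow> bool" where
  "walk Q \<equiv> pre_digraph.awalk (double_quiver Q)"

definition walk_inv :: "('a \<times> bool) list \<Rightarrow> ('a \<times> bool) list" where
  "walk_inv w = rev (map (\<lambda>(a, d). (a, \<not> d)) w)"

abbreviation path_walk :: "'a list \<Rightarrow> ('a \<times> bool) list" where
  "path_walk p \<equiv> map (\<lambda>a. (a, True)) p"

text \<open>A relation is a combination of parallel paths that lies in the ideal.\<close>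

definition minimal_relation ::
    "(('v, 'a) qpath \<Rightarrow>\<^sub>0 'k::field) set \<Rightarrow> (('v, 'a) qpath \<Rightarrow>\<^sub>0 'k) \<Rightarrow> bool" where
  "minimal_relation I r \<longleftrightarrow>
     r \<in> I \<and>
     (\<exists>x y. \<forall>u \<in> Poly_Mapping.keys r. \<exists>p. u = (x, p, y)) \<and>
     (\<forall>s. s \<noteq> 0 \<and> s \<noteq> r \<and>
        (\<forall>u \<in> Poly_Mapping.keys s. Poly_Mapping.lookup s u = Poly_Mapping.lookup r u) \<longrightarrow> s \<notin> I)"

definition minimally_related ::
    "(('v, 'a) qpath \<Rightarrow>\<^sub>0 'k::field) set \<Rightarrow> (('v, 'a) qpath \<times> ('v, 'a) qpath) set" where
  "minimally_related I =
     {(u, v). \<exists>r. minimal_relation I r \<and> u \<in> Poly_Mapping.keys r \<and> v \<in> Poly_Mapping.keys r}"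

text \<open>
  \<open>homotopic Q S x w w' y\<close>: the walks \<open>w\<close> and \<open>w'\<close> from \<open>x\<close> to \<open>y\<close> are equivalent, where
  \<open>S\<close> is the set of pairs of paths that are identified in addition to cancelling inverses.
\<close>

inductive homotopic ::
    "('v, 'a) pre_digraph \<Rightarrow> (('v, 'a) qpath \<times> ('v, 'a) qpath) set \<Rightarrow>
     'v \<Rightarrow> ('a \<times> bool) list \<Rightarrow> ('a \<times> bool) list \<Rightarrow> 'v \<Rightarrow> bool"
  for Q :: "('v, 'a) pre_digraph" and S :: "(('v, 'a) qpath \<times> ('v, 'a) qpath) set" where
  homotopic_refl: "walk Q x w y \<Longrightarrow> homotopic Q S x w w y"
| homotopic_sym: "homotopic Q S x w w' y \<Longrightarrow> homotopic Q S x w' w y"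
| homotopic_trans: "homotopic Q S x w w' y \<Longrightarrow> homotopic Q S x w' w'' y \<Longrightarrow> homotopic Q S x w w'' y"
| homotopic_concat: "homotopic Q S x v v' y \<Longrightarrow> homotopic Q S y w w' z \<Longrightarrow>
    homotopic Q S x (v @ w) (v' @ w') z"
| homotopic_cancel_source: "a \<in> arcs Q \<Longrightarrow>
    homotopic Q S (tail Q a) [(a, True), (a, False)] [] (tail Q a)"
| homotopic_cancel_target: "a \<in> arcs Q \<Longrightarrow>
    homotopic Q S (head Q a) [(a, False), (a, True)] [] (head Q a)"
| homotopic_identify: "((x, p, y), (x, q, y)) \<in> S \<Longrightarrow> (x, p, y) \<in> paths Q \<Longrightarrow> (x, q, y) \<in> paths Q \<Longrightarrow>
    homotopic Q S x (path_walk p) (path_walk q) y"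

definition homotopy ::
    "('v, 'a) pre_digraph \<Rightarrow> (('v, 'a) qpath \<times> ('v, 'a) qpath) set \<Rightarrow> 'v \<Rightarrow>
     (('a \<times> bool) list \<times> ('a \<times> bool) list) set" where
  "homotopy Q S x = {(w, w'). homotopic Q S x w w' x}"

definition walk_group ::
    "('v, 'a) pre_digraph \<Rightarrow> (('v, 'a) qpath \<times> ('v, 'a) qpath) set \<Rightarrow> 'v \<Rightarrow>
     ('a \<times> bool) list set monoid" where
  "walk_group Q S x =
     \<lparr>carrier = {w. walk Q x w x} // homotopy Q S x,
      monoid.mult = (\<lambda>U V. \<Union>u\<in>U. \<Union>v\<in>V. homotopy Q S x `` {v @ u}),
      one = homotopy Q S x `` {[]}\<rparr>"

definition fundamental_group ::
    "('v, 'a) pre_digraph \<Rightarrow> (('v, 'a) qpath \<Rightarrow>\<^sub>0 'k::field) set \<Rightarrow> 'v \<Rightarrow>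
     ('a \<times> bool) list set monoid" where
  "fundamental_group Q I x = walk_group Q (minimally_related I) x"

definition quiver_fundamental_group ::
    "('v, 'a) pre_digraph \<Rightarrow> 'v \<Rightarrow> ('a \<times> bool) list set monoid" where
  "quiver_fundamental_group Q x = walk_group Q {} x"

text \<open>The generators are \<open>v\<^sup>-\<^sup>1 u'\<^sup>-\<^sup>1 u v\<close>; this walk first runs through \<open>v\<close>.\<close>

definition subquiver_subgroup ::
    "('v, 'a) pre_digraph \<Rightarrow> (('v, 'a) qpath \<Rightarrow>\<^sub>0 'k::field) set \<Rightarrow> ('v, 'a) pre_digraph \<Rightarrow> 'v \<Rightarrow>
     ('a \<times> bool) list set set" where
  "subquiver_subgroup QA IA QB z =
     generate (fundamental_group QA IA z)
       {homotopy QA (minimally_related IA) z `` {v @ u @ walk_inv u' @ walk_inv v} | u u' v.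
          \<exists>x y. walk QB x u y \<and> walk QB x u' y \<and> walk QA z v x}"


section \<open>Extended maximal trees\<close>

text \<open>
  The library's \<^const>\<open>tree\<close> only excludes directed cycles. Here a tree is a connected quiver whose
  underlying undirected multigraph has no cycle, that is, without a nonempty closed walk in which no
  arrow is immediately followed by its inverse or vice versa.
\<close>

definition reduced_walk :: "('a \<times> bool) list \<Rightarrow> bool" where
  "reduced_walk w \<longleftrightarrow> (\<nexists>us a d vs. w = us @ [(a, d), (a, \<not> d)] @ vs)"

definition quiver_tree :: "('v, 'a) pre_digraph \<Rightarrow> bool" where
  "quiver_tree T \<longleftrightarrow>
     Digraph_Component.connected T \<and> (\<nexists>x w. walk T x w x \<and> reduced_walk w \<and> w \<noteq> [])"

abbreviation maximal_tree :: "('v, 'a) pre_digraph \<Rightarrow> ('v, 'a) pre_digraph \<Rightarrow> bool" where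
  "maximal_tree T Q \<equiv> pre_digraph.max_subgraph Q quiver_tree T"

abbreviation quiver_component :: "('v, 'a) pre_digraph \<Rightarrow> ('v, 'a) pre_digraph \<Rightarrow> bool" where
  "quiver_component C Q \<equiv> pre_digraph.max_subgraph Q Digraph_Component.connected C"

definition extended_maximal_tree ::
    "('v, 'a) pre_digraph \<Rightarrow> ('v, 'a) pre_digraph \<Rightarrow> ('v, 'a) pre_digraph \<Rightarrow> bool" where
  "extended_maximal_tree QA QB T \<longleftrightarrow>
     maximal_tree T QA \<and>
     (\<forall>C. quiver_component C QB \<longrightarrow> (\<exists>F. maximal_tree F C \<and> subgraph F T))"

definition relative_quiver ::
    "('v, 'a) pre_digraph \<Rightarrow> ('v, 'a) pre_digraph \<Rightarrow> ('v, 'a) pre_digraph \<Rightarrow> ('v, 'a) pre_digraph" where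
  "relative_quiver QA QB T = QA\<lparr>arcs := (arcs QA - arcs QB) \<union> arcs T\<rparr>"


section \<open>The path algebra is a ring, the fundamental group is a group, and the subgroup is normal\<close>

abbreviation path_mult where "path_mult Q \<equiv> monoid.mult (path_algebra Q)"

lemma basis_mult_0: "basis_mult u v 0 = 0"
  by (auto simp: basis_mult_def split: prod.splits)

lemma path_mult_expand:
  assumes "finite U" "finite V" "Poly_Mapping.keys f \<subseteq> U" "Poly_Mapping.keys g \<subseteq> V"
  shows "path_mult Q f g = (\<Sum>u\<in>U. \<Sum>v\<in>V. basis_mult u v (Poly_Mapping.lookup f u * Poly_Mapping.lookup g v))"
proof -
  have "(\<Sum>u\<in>U. \<Sum>v\<in>V. basis_mult u v (Poly_Mapping.lookup f u * Poly_Mapping.lookup g v)) = (\<Sum>u\<in>U. \<Sum>v\<in>Poly_Mapping.keys g. basis_mult u v (Poly_Mapping.lookup f u * Poly_Mapping.lookup g v))"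
    by (rule sum.cong[OF refl], rule sum.mono_neutral_right) (use assms in \<open>auto simp: in_keys_iff basis_mult_0\<close>)
  also have "... = (\<Sum>u\<in>Poly_Mapping.keys f. \<Sum>v\<in>Poly_Mapping.keys g. basis_mult u v (Poly_Mapping.lookup f u * Poly_Mapping.lookup g v))"
    by (intro sum.mono_neutral_right) (use assms in \<open>auto simp: in_keys_iff basis_mult_0\<close>)
  finally show ?thesis by (simp add: path_algebra_def)
qed

lemma basis_mult_add: "basis_mult u v (a + b) = basis_mult u v a + basis_mult u v b"
  by (auto simp: basis_mult_def single_add split: prod.splits)

lemma path_mult_add_l: "path_mult Q (f + f') g = path_mult Q f g + path_mult Q f' g"
proof -
  let ?U = "Poly_Mapping.keys f \<union> Poly_Mapping.keys f'"
  have k: "Poly_Mapping.keys (f+f') \<subseteq> ?U" by (rule Poly_Mapping.keys_add)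
  show ?thesis using k
    by (simp add: path_mult_expand[of ?U "Poly_Mapping.keys g"] lookup_add distrib_right basis_mult_add sum.distrib)
qed

lemma path_mult_add_r: "path_mult Q g (f + f') = path_mult Q g f + path_mult Q g f'"
proof -
  let ?U = "Poly_Mapping.keys f \<union> Poly_Mapping.keys f'"
  have k: "Poly_Mapping.keys (f+f') \<subseteq> ?U" by (rule Poly_Mapping.keys_add)
  show ?thesis using k
    by (simp add: path_mult_expand[of "Poly_Mapping.keys g" ?U] lookup_add distrib_left basis_mult_add sum.distrib)
qed

lemma path_mult_0 [simp]: "path_mult Q 0 g = 0" "path_mult Q g 0 = 0"
  by (simp_all add: path_algebra_def)

lemma path_mult_sum_l: "path_mult Q (\<Sum>i\<in>I. F i) g = (\<Sum>i\<in>I. path_mult Q (F i) g)"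
  by (induction I rule: infinite_finite_induct) (simp_all add: path_mult_add_l)
lemma path_mult_sum_r: "path_mult Q g (\<Sum>i\<in>I. F i) = (\<Sum>i\<in>I. path_mult Q g (F i))"
  by (induction I rule: infinite_finite_induct) (simp_all add: path_mult_add_r)

lemma path_mult_single: "path_mult Q (Poly_Mapping.single u a) (Poly_Mapping.single v b) = basis_mult u v (a*b)"
  by (subst path_mult_expand[of "{u}" "{v}"]) auto

lemma poly_mapping_expand: "f = (\<Sum>u\<in>Poly_Mapping.keys f. Poly_Mapping.single u (Poly_Mapping.lookup f u))"
  by (rule poly_mapping_eqI) (auto simp: lookup_sum lookup_single when_def in_keys_iff)

lemma path_mult_assoc_single: "path_mult Q (path_mult Q (Poly_Mapping.single u a) (Poly_Mapping.single v b)) (Poly_Mapping.single w c)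
   = path_mult Q (Poly_Mapping.single u a) (path_mult Q (Poly_Mapping.single v b) (Poly_Mapping.single w c))"
  unfolding path_mult_single by (auto simp: basis_mult_def path_mult_single mult.assoc split: prod.splits)

lemma path_mult_assoc: "path_mult Q (path_mult Q f g) h = path_mult Q f (path_mult Q g h)"
proof -
  let ?s = "\<lambda>f u. Poly_Mapping.single u (Poly_Mapping.lookup f u)"
  have "path_mult Q (path_mult Q (sum (?s f) A) (sum (?s g) B)) (sum (?s h) C) = path_mult Q (sum (?s f) A) (path_mult Q (sum (?s g) B) (sum (?s h) C))" for A B C
    by (simp add: path_mult_sum_l path_mult_sum_r path_mult_assoc_single)
  from this[of "Poly_Mapping.keys f" "Poly_Mapping.keys g" "Poly_Mapping.keys h"]
  show ?thesis by (simp flip: poly_mapping_expand)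
qed

lemma path_mult_closed:
  assumes "wf_digraph Q" "Poly_Mapping.keys f \<subseteq> paths Q" "Poly_Mapping.keys g \<subseteq> paths Q"
  shows "Poly_Mapping.keys (path_mult Q f g) \<subseteq> paths Q"
proof -
  interpret wf_digraph Q by fact
  have "Poly_Mapping.keys (basis_mult u v c) \<subseteq> paths Q" if "u \<in> paths Q" "v \<in> paths Q" for u v c
    using that by (auto simp: basis_mult_def paths_def split: prod.splits if_splits intro: awalk_appendI)
  then show ?thesis using assms
    unfolding path_algebra_def monoid.select_convs
    by (intro order.trans[OF keys_sum] UN_least) blast
qed

lemma path_mult_one_single:
  assumes "fin_digraph Q" "u \<in> paths Q"
  shows "path_mult Q (one (path_algebra Q)) (Poly_Mapping.single u c) = Poly_Mapping.single u c"
   "path_mult Q (Poly_Mapping.single u c) (one (path_algebra Q)) = Poly_Mapping.single u c"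
proof -
  interpret fin_digraph Q by fact
  obtain x p y where u: "u = (x,p,y)" by (cases u)
  with assms have xy: "x \<in> verts Q" "y \<in> verts Q" by (auto simp: paths_def)
  have o: "one (path_algebra Q) = (\<Sum>x\<in>verts Q. Poly_Mapping.single (x, [], x) 1)" by (simp add: path_algebra_def)
  show "path_mult Q (one (path_algebra Q)) (Poly_Mapping.single u c) = Poly_Mapping.single u c"
     "path_mult Q (Poly_Mapping.single u c) (one (path_algebra Q)) = Poly_Mapping.single u c"
    unfolding o path_mult_sum_l path_mult_sum_r path_mult_single
    using xy by (auto simp: u basis_mult_def if_distrib sum.delta sum.delta')
qed

lemma ring_path_algebra:
  assumes "fin_digraph Q" shows "ring (path_algebra Q :: (_ \<Rightarrow>\<^sub>0 'k::field) ring)" (is "ring ?R")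
proof -
  interpret fin_digraph Q by fact
  have one: "one ?R \<in> carrier ?R"
  proof -
    have "Poly_Mapping.keys (\<Sum>x\<in>verts Q. Poly_Mapping.single (x, [], x) (1::'k)) \<subseteq> paths Q"
      by (rule order.trans[OF keys_sum]) (auto simp: paths_def awalk_Nil_iff)
    then show ?thesis by (simp add: path_algebra_def)
  qed
  have l: "path_mult Q (one ?R) f = f" "path_mult Q f (one ?R) = f" if "f \<in> carrier ?R" for f
  proof -
    have f: "u \<in> paths Q" if "u \<in> Poly_Mapping.keys f" for u
      using that \<open>f \<in> _\<close> by (auto simp: path_algebra_def)
    let ?s = "\<lambda>u. Poly_Mapping.single u (Poly_Mapping.lookup f u)"
    have "path_mult Q (one ?R) (sum ?s (Poly_Mapping.keys f)) = sum ?s (Poly_Mapping.keys f)"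
         "path_mult Q (sum ?s (Poly_Mapping.keys f)) (one ?R) = sum ?s (Poly_Mapping.keys f)"
      unfolding path_mult_sum_l path_mult_sum_r
      by (rule sum.cong; simp add: path_mult_one_single assms f)+
    then show "path_mult Q (one ?R) f = f" "path_mult Q f (one ?R) = f" by (simp_all flip: poly_mapping_expand)
  qed
  show ?thesis
  proof (rule ringI)
    show "abelian_group ?R"
    proof (rule abelian_groupI)
      fix f assume "f \<in> carrier ?R"
      then show "\<exists>g\<in>carrier ?R. g \<oplus>\<^bsub>?R\<^esub> f = \<zero>\<^bsub>?R\<^esub>"
        by (intro bexI[of _ "-f"]) (auto simp: path_algebra_def)
    qed (auto simp: path_algebra_def add.assoc add.commute dest: subsetD[OF Poly_Mapping.keys_add])
    show "Group.monoid ?R"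
    proof
      show "\<And>x y. x \<in> carrier ?R \<Longrightarrow> y \<in> carrier ?R \<Longrightarrow> x \<otimes>\<^bsub>?R\<^esub> y \<in> carrier ?R"
        using path_mult_closed[OF wf_digraph] by (metis (mono_tags, lifting) mem_Collect_eq partial_object.select_convs(1) path_algebra_def)
    qed (use one l path_mult_assoc in blast)+
  qed (use path_mult_add_l path_mult_add_r in \<open>auto simp: path_algebra_def\<close>)
qed

lemma arcs_double: "arcs (double_quiver Q) = arcs Q \<times> UNIV"
  by (simp add: double_quiver_def)

lemma wf_double: "wf_digraph Q \<Longrightarrow> wf_digraph (double_quiver Q)"
  by (auto simp: wf_digraph_def double_quiver_def)

lemma awalk_path_walk:
  assumes "wf_digraph Q" "pre_digraph.awalk Q x p y"
  shows "walk Q x (path_walk p) y"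
  using assms(2)
proof (induction p arbitrary: x)
  case Nil
  then show ?case by (auto simp: pre_digraph.awalk_def pre_digraph.cas.simps double_quiver_def)
next
  case (Cons a p)
  have "pre_digraph.awalk Q (head Q a) p y"
    using Cons.prems assms(1)
    by (auto simp: pre_digraph.awalk_def pre_digraph.cas.simps wf_digraph_def)
  from Cons.IH[OF this] Cons.prems show ?case
    by (auto simp: pre_digraph.awalk_def pre_digraph.cas.simps double_quiver_def)
qed

lemma walk_append:
  assumes "wf_digraph Q" shows "walk Q x v y \<Longrightarrow> walk Q y w z \<Longrightarrow> walk Q x (v @ w) z"
proof -
  interpret wf_digraph "double_quiver Q" using assms by (rule wf_double)
  show "walk Q x v y \<Longrightarrow> walk Q y w z \<Longrightarrow> walk Q x (v @ w) z" by (rule awalk_appendI)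
qed

lemma walk_Cons:
  assumes "wf_digraph Q" shows "walk Q x (s # w) y \<longleftrightarrow> s \<in> arcs (double_quiver Q) \<and> tail (double_quiver Q) s = x \<and> walk Q (head (double_quiver Q) s) w y"
proof -
  interpret wf_digraph "double_quiver Q" using assms by (rule wf_double)
  show ?thesis by (auto simp: awalk_Cons_iff)
qed

lemma homotopic_walks:
  assumes "wf_digraph Q" "homotopic Q S x w w' y"
  shows "walk Q x w y \<and> walk Q x w' y"
  using assms(2)
proof (induction rule: homotopic.induct)
  case (homotopic_concat x v v' y w w' z)
  then show ?case using walk_append[OF assms(1)] by blast
next
  case (homotopic_identify x p y q)
  then show ?case using awalk_path_walk[OF assms(1)] by (auto simp: paths_def)
qed (use assms(1) in \<open>auto simp: pre_digraph.awalk_def pre_digraph.cas.simps double_quiver_def wf_digraph_def\<close>)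

lemma walk_inv_simps: "walk_inv [] = []" "walk_inv (s # w) = walk_inv w @ [(fst s, \<not> snd s)]"
  "walk_inv (v @ w) = walk_inv w @ walk_inv v" "walk_inv (walk_inv w) = w"
  by (auto simp: walk_inv_def case_prod_beta rev_map o_def)

lemma walk_inv_walk:
  assumes "wf_digraph Q" shows "walk Q x w y \<Longrightarrow> walk Q y (walk_inv w) x"
proof (induction w arbitrary: x)
  case Nil
  then show ?case by (auto simp: walk_inv_simps pre_digraph.awalk_def pre_digraph.cas.simps)
next
  case (Cons s w)
  obtain a d where s: "s = (a, d)" by (cases s)
  have "walk Q y (walk_inv w) (head (double_quiver Q) s)" "a \<in> arcs Q" "tail (double_quiver Q) s = x"
    using Cons.prems Cons.IH unfolding walk_Cons[OF assms] by (auto simp: s arcs_double)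
  moreover from this(2,3) have "walk Q (head (double_quiver Q) s) [(a, \<not> d)] x"
    using assms by (auto simp: pre_digraph.awalk_def pre_digraph.cas.simps double_quiver_def s wf_digraph_def)
  ultimately show ?case by (auto simp: walk_inv_simps s intro: walk_append[OF assms])
qed

lemma homotopic_cancel:
  assumes "wf_digraph Q" shows "walk Q x w y \<Longrightarrow> homotopic Q S x (w @ walk_inv w) [] x"
proof (induction w arbitrary: x)
  case Nil
  then show ?case by (auto simp: walk_inv_simps pre_digraph.awalk_def pre_digraph.cas.simps intro!: homotopic_refl)
next
  case (Cons s w)
  obtain a d where s: "s = (a, d)" by (cases s)
  let ?h = "head (double_quiver Q) s"
  have h: "homotopic Q S ?h (w @ walk_inv w) [] ?h" "a \<in> arcs Q" "tail (double_quiver Q) s = x"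
    using Cons.prems Cons.IH unfolding walk_Cons[OF assms] by (auto simp: s arcs_double)
  have c: "homotopic Q S x [s, (a, \<not> d)] [] x"
    using h(2,3) homotopic_cancel_source[of a Q S] homotopic_cancel_target[of a Q S]
    by (cases d) (auto simp: s double_quiver_def)
  have w: "walk Q x [s] ?h" "walk Q ?h [(a, \<not> d)] x"
    using h(2,3) assms by (auto simp: pre_digraph.awalk_def pre_digraph.cas.simps double_quiver_def s wf_digraph_def)
  have "homotopic Q S x ([s] @ (w @ walk_inv w) @ [(a, \<not> d)]) ([s] @ [] @ [(a, \<not> d)]) x"
    by (intro homotopic_concat[of _ _ _ _ _ ?h] h(1) homotopic_refl w)
  with c show ?case by (auto simp: walk_inv_simps s intro: homotopic_trans)
qed

lemma equiv_homotopy: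
  assumes "wf_digraph Q" shows "equiv {w. walk Q x w x} (homotopy Q S x)"
  by (rule equivI) (auto simp: homotopy_def refl_on_def sym_def trans_def
        intro: homotopic.intros dest: homotopic_walks[OF assms])

lemma walk_group_mult:
  assumes "wf_digraph Q" "walk Q x u x" "walk Q x v x"
  shows "monoid.mult (walk_group Q S x) (homotopy Q S x `` {u}) (homotopy Q S x `` {v}) = homotopy Q S x `` {v @ u}"
proof -
  note eq = equiv_homotopy[OF assms(1), of x S]
  have "homotopy Q S x `` {v' @ u'} = homotopy Q S x `` {v @ u}"
    if "u' \<in> homotopy Q S x `` {u}" "v' \<in> homotopy Q S x `` {v}" for u' v'
    by (rule equiv_class_eq[OF eq]) (use that in \<open>auto simp: homotopy_def intro: homotopic.intros\<close>)
  moreover have "u \<in> homotopy Q S x `` {u}" "v \<in> homotopy Q S x `` {v}"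
    using assms by (auto simp: homotopy_def intro: homotopic_refl)
  ultimately show ?thesis unfolding walk_group_def monoid.select_convs by blast
qed

lemma walk_group_carrier: "carrier (walk_group Q S x) = (\<lambda>w. homotopy Q S x `` {w}) ` {w. walk Q x w x}"
  by (auto simp: walk_group_def quotient_def)

lemma walk_Nil: "x \<in> verts Q \<Longrightarrow> walk Q x [] x"
  by (simp add: pre_digraph.awalk_def pre_digraph.cas.simps double_quiver_def)

lemma group_walk_group:
  assumes wf: "wf_digraph Q" and x: "x \<in> verts Q"
  shows "group (walk_group Q S x)"
proof (rule groupI)
  note m = walk_group_mult[OF wf]
  have o: "one (walk_group Q S x) = homotopy Q S x `` {[]}" by (simp add: walk_group_def)
  show "one (walk_group Q S x) \<in> carrier (walk_group Q S x)"
    using walk_Nil[OF x] by (auto simp: o walk_group_carrier)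
  fix U assume U: "U \<in> carrier (walk_group Q S x)"
  then obtain u where u: "walk Q x u x" "U = homotopy Q S x `` {u}" by (auto simp: walk_group_carrier)
  show "one (walk_group Q S x) \<otimes>\<^bsub>walk_group Q S x\<^esub> U = U"
    using walk_Nil[OF x] by (simp add: u o m)
  have "homotopy Q S x `` {u @ walk_inv u} = homotopy Q S x `` {[]}"
    by (rule equiv_class_eq[OF equiv_homotopy[OF wf]]) (use homotopic_cancel[OF wf u(1)] in \<open>auto simp: homotopy_def\<close>)
  then show "\<exists>V\<in>carrier (walk_group Q S x). V \<otimes>\<^bsub>walk_group Q S x\<^esub> U = one (walk_group Q S x)"
    using walk_inv_walk[OF wf u(1)] u
    by (intro bexI[of _ "homotopy Q S x `` {walk_inv u}"]) (auto simp: m o walk_group_carrier)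
  fix V assume "V \<in> carrier (walk_group Q S x)"
  then obtain v where v: "walk Q x v x" "V = homotopy Q S x `` {v}" by (auto simp: walk_group_carrier)
  show "U \<otimes>\<^bsub>walk_group Q S x\<^esub> V \<in> carrier (walk_group Q S x)"
    using u v walk_append[OF wf] by (auto simp: m walk_group_carrier)
  fix W assume "W \<in> carrier (walk_group Q S x)"
  then obtain w where w: "walk Q x w x" "W = homotopy Q S x `` {w}" by (auto simp: walk_group_carrier)
  show "U \<otimes>\<^bsub>walk_group Q S x\<^esub> V \<otimes>\<^bsub>walk_group Q S x\<^esub> W = U \<otimes>\<^bsub>walk_group Q S x\<^esub> (V \<otimes>\<^bsub>walk_group Q S x\<^esub> W)"
    using u v w walk_append[OF wf] by (auto simp: m)
qed

lemma walk_subgraph: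
  assumes "subgraph H G" "walk H x w y" shows "walk G x w y"
proof -
  have t: "tail (double_quiver H) = tail (double_quiver G)" "head (double_quiver H) = head (double_quiver G)"
    using assms(1) by (auto simp: subgraph_def compatible_def double_quiver_def)
  have c: "pre_digraph.cas (double_quiver H) x w y = pre_digraph.cas (double_quiver G) x w y" for x
    by (induction w arbitrary: x) (auto simp: pre_digraph.cas.simps t)
  show ?thesis using assms unfolding pre_digraph.awalk_def c by (auto simp: subgraph_def double_quiver_def)
qed

lemma normal_subquiver_subgroup:
  assumes sub: "subgraph QB QA" and z: "z \<in> verts QA"
  shows "subquiver_subgroup QA IA QB z \<lhd> fundamental_group QA IA z"
proof -
  have wf: "wf_digraph QA" using sub by (simp add: subgraph_def)
  have wfB: "wf_digraph QB" using sub by (simp add: subgraph_def)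
  let ?S = "minimally_related IA" let ?h = "homotopy QA ?S z" let ?G = "walk_group QA ?S z"
  interpret group ?G by (rule group_walk_group[OF wf z])
  note m = walk_group_mult[OF wf, of z _ _ ?S]
  let ?X = "{?h `` {v @ u @ walk_inv u' @ walk_inv v} | u u' v.
          \<exists>x y. walk QB x u y \<and> walk QB x u' y \<and> walk QA z v x}"
  have wk: "walk QA z (v @ u @ walk_inv u' @ walk_inv v) z"
    if "walk QB x u y" "walk QB x u' y" "walk QA z v x" for u u' v x y
    using that walk_subgraph[OF sub] by (blast intro: walk_append[OF wf] walk_inv_walk[OF wf])
  have "generate ?G ?X \<lhd> ?G"
  proof (rule normal_generateI)
    show "?X \<subseteq> carrier ?G" using wk by (auto simp: walk_group_carrier)
    fix h g assume "h \<in> ?X" "g \<in> carrier ?G"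
    then obtain u u' v x y w where h: "h = ?h `` {v @ u @ walk_inv u' @ walk_inv v}"
      "walk QB x u y" "walk QB x u' y" "walk QA z v x" and g: "g = ?h `` {w}" "walk QA z w z"
      by (auto simp: walk_group_carrier)
    have w': "walk QA z (walk_inv w) z" using g walk_inv_walk[OF wf] by blast
    have i: "inv\<^bsub>?G\<^esub> g = ?h `` {walk_inv w}"
    proof (rule inv_equality)
      have "?h `` {w @ walk_inv w} = ?h `` {[]}"
        by (rule equiv_class_eq[OF equiv_homotopy[OF wf]]) (use homotopic_cancel[OF wf g(2)] in \<open>auto simp: homotopy_def\<close>)
      then show "?h `` {walk_inv w} \<otimes>\<^bsub>?G\<^esub> g = \<one>\<^bsub>?G\<^esub>"
        using w' g by (simp add: m) (simp add: walk_group_def)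
    qed (use g w' in \<open>auto simp: walk_group_carrier\<close>)
    have "g \<otimes>\<^bsub>?G\<^esub> h \<otimes>\<^bsub>?G\<^esub> inv\<^bsub>?G\<^esub> g = ?h `` {(walk_inv w @ v) @ u @ walk_inv u' @ walk_inv (walk_inv w @ v)}"
      using wk[OF h(2-4)] g(2) w' walk_append[OF wf wk[OF h(2-4)] g(2)]
      unfolding i unfolding g(1) h(1) by (simp add: m walk_inv_simps)
    moreover have "walk QA z (walk_inv w @ v) x" using w' h walk_append[OF wf] by blast
    ultimately show "g \<otimes>\<^bsub>?G\<^esub> h \<otimes>\<^bsub>?G\<^esub> inv\<^bsub>?G\<^esub> g \<in> ?X" using h by blast
  qed
  then show ?thesis by (simp add: subquiver_subgroup_def fundamental_group_def)
qed

end

theory Submission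
  imports Defs
begin

text \<open>
  Since \<open>I\<^sub>A\<close> is monomial, minimal relations are multiples of single paths and impose no homotopies.
  Every arrow of \<open>Q\<^sub>B\<close> outside \<open>T\<close> is parallel to a walk that lies in both \<open>T\<close> and \<open>Q\<^sub>B\<close>, because
  \<open>T\<close> contains a maximal tree of each component of \<open>Q\<^sub>B\<close>. Substituting these walks for the arrows maps
  walks in \<open>Q\<^sub>A\<close> to walks in the relative quiver, fixes the walks of the latter, and sends walks in
  \<open>Q\<^sub>B\<close> to walks in the tree \<open>T\<close>, where parallel walks are homotopic; so \<open>N\<^sub>B\<close> lies in the kernel of
  the induced surjection of fundamental groups. Conversely, the substitution changes a walk only by
  conjugates of the generators of \<open>N\<^sub>B\<close>, so \<open>N\<^sub>B\<close> is the whole kernel. Connectedness of the algebra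
  is needed to make \<open>Q\<^sub>A\<close> connected, so that \<open>T\<close> is spanning and the two base points may differ.
\<close>

section \<open>Walks and homotopy\<close>

lemma walk_Nil_iff: "walk Q x [] y \<longleftrightarrow> x = y \<and> x \<in> verts Q"
  by (auto simp: pre_digraph.awalk_def pre_digraph.cas.simps double_quiver_def)

lemma double_quiver_simps [simp]:
  "verts (double_quiver Q) = verts Q"
  "tail (double_quiver Q) (a, d) = (if d then tail Q a else head Q a)"
  "head (double_quiver Q) (a, d) = (if d then head Q a else tail Q a)"
  by (auto simp: double_quiver_def)

lemma double_quiver_tail_head_in_verts:
  assumes "wf_digraph Q" "s \<in> arcs (double_quiver Q)"
  shows "tail (double_quiver Q) s \<in> verts Q" "head (double_quiver Q) s \<in> verts Q"
  using wf_digraph.tail_in_verts[OF wf_double[OF assms(1)] assms(2)]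
    wf_digraph.head_in_verts[OF wf_double[OF assms(1)] assms(2)] by auto

lemma walk_step:
  assumes "wf_digraph Q" "s \<in> arcs (double_quiver Q)"
  shows "walk Q (tail (double_quiver Q) s) [s] (head (double_quiver Q) s)"
  using assms by (simp add: walk_Cons walk_Nil_iff double_quiver_tail_head_in_verts)

lemma walk_arc: "wf_digraph Q \<Longrightarrow> a \<in> arcs Q \<Longrightarrow> walk Q (tail Q a) [(a, True)] (head Q a)"
  using walk_step[of Q "(a, True)"] by (simp add: arcs_double)

lemma walk_verts: "walk Q x w y \<Longrightarrow> wf_digraph Q \<Longrightarrow> x \<in> verts Q \<and> y \<in> verts Q"
  using wf_digraph.awalk_last_in_verts[OF wf_double] wf_digraph.awalk_hd_in_verts[OF wf_double]
  by fastforce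

lemma walk_append_iff:
  assumes "wf_digraph Q"
  shows "walk Q x (v @ w) z \<longleftrightarrow> (\<exists>y. walk Q x v y \<and> walk Q y w z)"
proof (induction v arbitrary: x)
  case Nil
  then show ?case using walk_verts[OF _ assms] by (auto simp: walk_Nil_iff)
next
  case (Cons s v)
  then show ?case by (auto simp: walk_Cons[OF assms])
qed

lemma subgraph_double_quiver:
  assumes "subgraph H G"
  shows "tail (double_quiver H) = tail (double_quiver G)" "head (double_quiver H) = head (double_quiver G)"
    "arcs (double_quiver H) \<subseteq> arcs (double_quiver G)"
  using assms by (auto simp: subgraph_def compatible_def double_quiver_def)

lemma homotopic_subgraph:
  assumes "subgraph H G" "homotopic H {} x w w' y"
  shows "homotopic G {} x w w' y"
  using assms(2)
proof (induction rule: homotopic.induct)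
  case (homotopic_refl x w y)
  then show ?case by (intro homotopic.homotopic_refl walk_subgraph[OF assms(1)])
next
  case (homotopic_cancel_source a)
  then show ?case using assms(1) homotopic.homotopic_cancel_source[of a G "{}"]
    by (auto simp: subgraph_def compatible_def)
next
  case (homotopic_cancel_target a)
  then show ?case using assms(1) homotopic.homotopic_cancel_target[of a G "{}"]
    by (auto simp: subgraph_def compatible_def)
qed (auto intro: homotopic.intros)

text \<open>A pair in the identity relation only identifies a path with itself, so
  \<open>homotopic_identify\<close> yields nothing beyond reflexivity. This reduces the fundamental
  group of a monomial presentation to that of the bare quiver.\<close>

lemma homotopic_trivial_relations:
  assumes wf: "wf_digraph Q" and S: "S \<subseteq> Id"
  shows "homotopic Q S x w w' y \<longleftrightarrow> homotopic Q {} x w w' y"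
proof
  show "homotopic Q {} x w w' y" if "homotopic Q S x w w' y"
    using that
  proof (induction rule: homotopic.induct)
    case (homotopic_identify x p y q)
    then have "p = q" "walk Q x (path_walk p) y" using S awalk_path_walk[OF wf] by (auto simp: paths_def)
    then show ?case by (auto intro: homotopic.homotopic_refl)
  qed (auto intro: homotopic.intros)
  show "homotopic Q S x w w' y" if "homotopic Q {} x w w' y"
    using that by (induction rule: homotopic.induct) (auto intro: homotopic.intros)
qed

text \<open>Removes a detour inside a longer walk. Taking \<open>p\<close> or \<open>q\<close> empty
  covers detours at the ends, and an inverse walk for \<open>w\<close> covers the opposite order of
  cancellation.\<close>

lemma homotopic_cancel_middle:
  assumes wf: "wf_digraph Q" and "walk Q x p y" "walk Q y w y'" "walk Q y q z"
  shows "homotopic Q S x (p @ w @ walk_inv w @ q) (p @ q) z"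
proof -
  have "homotopic Q S x (p @ (w @ walk_inv w) @ q) (p @ [] @ q) z"
    by (intro homotopic_concat[where y = y] homotopic_cancel[OF wf] homotopic_refl assms(2,4)) fact
  then show ?thesis by simp
qed

lemma homotopy_class_eq_iff:
  assumes "wf_digraph Q" "walk Q x v x" "walk Q x w x"
  shows "homotopy Q S x `` {v} = homotopy Q S x `` {w} \<longleftrightarrow> homotopic Q S x v w x"
  using eq_equiv_class_iff[OF equiv_homotopy[OF assms(1)], of v x w S] assms(2,3)
  by (simp add: homotopy_def)

lemma walk_group_one: "one (walk_group Q S x) = homotopy Q S x `` {[]}"
  by (simp add: walk_group_def)

section \<open>Connected quivers and maximal trees\<close>

text \<open>\<open>connected\<close> means strong connectedness of the symmetric closure. That
  closure has the same pairs of ends as the double quiver, where reachability is the existence of a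
  walk.\<close>

lemma connected_iff_walk:
  assumes "wf_digraph Q"
  shows "Digraph_Component.connected Q \<longleftrightarrow>
    verts Q \<noteq> {} \<and> (\<forall>u\<in>verts Q. \<forall>v\<in>verts Q. \<exists>w. walk Q u w v)"
proof -
  have "arcs_ends (double_quiver Q) = (\<Union>a\<in>arcs Q. \<Union>d. {arc_to_ends (double_quiver Q) (a, d)})"
    unfolding arcs_ends_def arcs_double by blast
  also have "\<dots> = arcs_ends (with_proj (mk_symmetric Q))"
    by (simp add: arcs_ends_def arc_to_ends_def mk_symmetric_def UNIV_bool insert_commute)
  finally have "arcs_ends (with_proj (mk_symmetric Q)) = arcs_ends (double_quiver Q)" ..
  then have "u \<rightarrow>\<^sup>*\<^bsub>with_proj (mk_symmetric Q)\<^esub> v \<longleftrightarrow> (\<exists>w. walk Q u w v)" for u v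
    using wf_digraph.reachable_awalk[OF wf_double[OF assms], of u v]
    by (simp add: reachable_def mk_symmetric_def)
  then show ?thesis
    by (simp add: Digraph_Component.connected_def strongly_connected_def mk_symmetric_def)
qed

text \<open>Either the first step leaves \<open>V\<close> or the rest of the walk still starts in
  \<open>V\<close>. This will supply the arrow by which a non-spanning tree can be enlarged.\<close>

lemma walk_leaves_set:
  assumes wf: "wf_digraph Q"
  shows "walk Q u w v \<Longrightarrow> u \<in> V \<Longrightarrow> v \<notin> V \<Longrightarrow>
    \<exists>s \<in> arcs (double_quiver Q). tail (double_quiver Q) s \<in> V \<and> head (double_quiver Q) s \<notin> V"
  by (induction w arbitrary: u) (auto simp: walk_Nil_iff walk_Cons[OF wf])

section \<open>Reduced walks, and growing a tree to a spanning one\<close>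

lemma reduced_walk_appendD:
  assumes "reduced_walk (v @ w)" shows "reduced_walk v" "reduced_walk w"
  using assms unfolding reduced_walk_def by (metis append.assoc)+

lemma not_reduced_walk_backtrack: "\<not> reduced_walk ((a, d) # (a, \<not> d) # w)"
  unfolding reduced_walk_def by (metis append_Cons append_Nil)

text \<open>The signed arrow \<open>s\<close> treats both orientations of the new arrow at once. The
  new vertex meets no other arrow, so a reduced walk that enters it can only stop there, and a
  reduced walk between old vertices stays in \<open>F\<close>. A reduced cycle at the new vertex
  would leave by the inverse of \<open>s\<close> and return by \<open>s\<close>; what lies between
  would be a reduced cycle of \<open>F\<close>.\<close>

lemma quiver_tree_add_leaf:
  assumes wf: "wf_digraph F" and tree: "quiver_tree F"
    and s: "s = (a, d)" "tail (double_quiver F) s \<in> verts F" "head (double_quiver F) s \<notin> verts F"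
    and F': "F' = F\<lparr>verts := insert (head (double_quiver F) s) (verts F), arcs := insert a (arcs F)\<rparr>"
  shows "wf_digraph F'" "subgraph F F'" "quiver_tree F'"
proof -
  let ?t = "tail (double_quiver F)" and ?h = "head (double_quiver F)"
  have dq: "tail (double_quiver F') = ?t" "head (double_quiver F') = ?h"
    "arcs (double_quiver F') = {(a, d), (a, \<not> d)} \<union> arcs (double_quiver F)"
    by (auto simp: F' double_quiver_def fun_eq_iff)
  show wf': "wf_digraph F'"
    using wf s by (auto simp: F' wf_digraph_def split: if_splits)
  show sub: "subgraph F F'"
    using wf wf' by (auto simp: F' subgraph_def compatible_def)
  have r: "(a, \<not> d) \<in> arcs (double_quiver F')" "s \<in> arcs (double_quiver F')"
    "?t (a, \<not> d) = ?h s" "?h (a, \<not> d) = ?t s" by (auto simp: s(1) dq)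
  note cons = walk_Cons[OF wf', unfolded dq]
  have walk_s: "walk F' (?t s) [s] (?h s)"
    using walk_step[OF wf' r(2)] by (simp add: dq)
  have conn: "Digraph_Component.connected F'"
    unfolding connected_iff_walk[OF wf']
  proof (intro conjI ballI)
    show "verts F' \<noteq> {}" by (simp add: F')
    have base: "\<exists>w. walk F' (?t s) w u" if "u \<in> verts F'" for u
    proof (cases "u \<in> verts F")
      case True
      then have "\<exists>w. walk F (?t s) w u"
        using tree s(2) connected_iff_walk[OF wf] unfolding quiver_tree_def by blast
      then show ?thesis using walk_subgraph[OF sub] by blast
    next
      case False
      then show ?thesis using that walk_s by (auto simp: F')
    qed
    fix u v assume "u \<in> verts F'" "v \<in> verts F'"
    then obtain p q where "walk F' (?t s) p u" "walk F' (?t s) q v" using base by metis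
    then show "\<exists>w. walk F' u w v" using walk_append[OF wf'] walk_inv_walk[OF wf'] by blast
  qed
  have F_walk: "walk F x w y"
    if "walk F' x w y" "reduced_walk w" "x \<in> verts F" "y \<in> verts F" for x w y
    using that
  proof (induction w arbitrary: x)
    case Nil
    then show ?case by (simp add: walk_Nil_iff)
  next
    case (Cons t w)
    have t: "t \<in> {s, (a, \<not> d)} \<union> arcs (double_quiver F)" "?t t = x" "walk F' (?h t) w y"
      using Cons.prems(1) by (auto simp: cons dq s(1))
    have "t \<in> arcs (double_quiver F)"
    proof (rule ccontr)
      assume *: "t \<notin> arcs (double_quiver F)"
      moreover have "t \<noteq> (a, \<not> d)" using Cons.prems(3) r(3) s(3) t(2) by auto
      \<comment> \<open>The other new step, \<open>(a, \<not> d)\<close>, starts outside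
        \<open>F\<close>. After \<open>s\<close> the walk cannot end, and its only continuation
        backtracks.\<close>
      ultimately have ts: "t = s" using t(1) by auto
      then have "w \<noteq> []" using t(3) s(3) Cons.prems(4) by (auto simp: walk_Nil_iff)
      then obtain t' w' where w: "w = t' # w'" by (cases w) auto
      have t': "t' \<in> {s, (a, \<not> d)} \<union> arcs (double_quiver F)" "?t t' = ?h s"
        using t(3) by (auto simp: w cons dq s(1) ts)
      have "t' = (a, \<not> d)"
        using t' s(2,3) double_quiver_tail_head_in_verts[OF wf, of t'] by auto
      then show False using Cons.prems(2) by (simp add: w ts s(1) not_reduced_walk_backtrack)
    qed
    then show ?case
      using Cons.IH[OF t(3) _ _ Cons.prems(4)] t(2) reduced_walk_appendD(2)[of "[t]" w] Cons.prems(2)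
        double_quiver_tail_head_in_verts[OF wf, of t]
      by (simp add: walk_Cons[OF wf])
  qed
  have no_cycle: False if w: "walk F' x w x" "reduced_walk w" "w \<noteq> []" for x w
  proof (cases "x \<in> verts F")
    case True
    then show ?thesis using F_walk[OF w(1,2)] w tree by (auto simp: quiver_tree_def)
  next
    case False
    then have x: "x = ?h s" using walk_verts[OF w(1) wf'] by (auto simp: F')
    obtain t w' where w': "w = t # w'" using w(3) by (cases w) auto
    have t: "t \<in> {s, (a, \<not> d)} \<union> arcs (double_quiver F)" "?t t = x" "walk F' (?h t) w' x"
      using w(1) by (auto simp: cons dq s(1) w')
    have t': "t = (a, \<not> d)"
      using t(1,2) s(2,3) double_quiver_tail_head_in_verts[OF wf, of t] by (auto simp: x)
    have "w' \<noteq> []" using t(3) s(2,3) r(4) by (auto simp: walk_Nil_iff t' x)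
    then obtain w'' t'' where w'': "w' = w'' @ [t'']" by (cases w' rule: rev_cases) auto
    have b: "walk F' (?t s) w'' (?t t'')" "t'' \<in> {s, (a, \<not> d)} \<union> arcs (double_quiver F)" "?h t'' = ?h s"
      using t(3) r(4) by (auto simp: w'' t' walk_append_iff[OF wf'] cons walk_Nil_iff dq s(1) x)
    have t'': "t'' = s"
      using b(2,3) s(2,3) r(4) double_quiver_tail_head_in_verts[OF wf, of t''] by auto
    have red: "reduced_walk w''"
      using w(2) reduced_walk_appendD[of "[t] @ w''" "[t'']"] reduced_walk_appendD[of "[t]" w'']
      by (simp add: w' w'')
    \<comment> \<open>If nothing lay between, the cycle would be the inverse of \<open>s\<close>
      followed by \<open>s\<close>, which is not reduced.\<close>
    have "w'' \<noteq> []"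
      using w(2) not_reduced_walk_backtrack[of a "\<not> d" "[]"] by (auto simp: w' w'' t' t'' s(1))
    then show False
      using F_walk[OF b(1)[unfolded t''] red s(2) s(2)] red tree by (auto simp: quiver_tree_def)
  qed
  show "quiver_tree F'" unfolding quiver_tree_def using conn no_cycle by blast
qed

text \<open>Were a vertex of \<open>C\<close> missing, a walk in \<open>C\<close> towards it would
  leave \<open>F\<close> along some arrow, and adding that arrow as a leaf would give a larger
  tree.\<close>

lemma maximal_tree_spanning:
  assumes conn: "Digraph_Component.connected C" and max: "maximal_tree F C"
  shows "verts F = verts C"
proof (rule ccontr)
  assume neq: "verts F \<noteq> verts C"
  have sub: "subgraph F C" and tree: "quiver_tree F"
    and maxF: "\<And>H. H \<noteq> F \<Longrightarrow> subgraph F H \<Longrightarrow> subgraph H C \<Longrightarrow> \<not> quiver_tree H"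
    using max by (auto simp: pre_digraph.max_subgraph_def)
  have wf: "wf_digraph F" "wf_digraph C" using sub by (auto simp: subgraph_def)
  obtain v where v: "v \<in> verts C" "v \<notin> verts F" using neq sub by (auto simp: subgraph_def)
  obtain u where u: "u \<in> verts F" using tree by (auto simp: quiver_tree_def connected_iff_walk[OF wf(1)])
  have "\<exists>w. walk C u w v" using u v(1) sub conn connected_iff_walk[OF wf(2)] by (auto simp: subgraph_def)
  then obtain a d where s: "(a, d) \<in> arcs (double_quiver C)"
    "tail (double_quiver C) (a, d) \<in> verts F" "head (double_quiver C) (a, d) \<notin> verts F"
    using walk_leaves_set[OF wf(2) _ u v(2)] by (metis surj_pair)
  note dq = subgraph_double_quiver[OF sub]
  define F' where "F' = F\<lparr>verts := insert (head (double_quiver F) (a, d)) (verts F), arcs := insert a (arcs F)\<rparr>"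
  note add = quiver_tree_add_leaf[OF wf(1) tree refl s(2,3)[folded dq(1,2)] F'_def]
  have "subgraph F' C"
    using sub add(1) s(1) double_quiver_tail_head_in_verts[OF wf(2) s(1)] dq
    by (auto simp: F'_def subgraph_def compatible_def arcs_double split: if_splits)
  moreover have "F' \<noteq> F" using s(3) dq by (auto simp: F'_def dest!: arg_cong[where f = verts])
  ultimately show False using maxF[OF _ add(2)] add(3) by blast
qed

text \<open>The component is the subquiver induced on the set \<open>V\<close> of vertices reachable
  from \<open>x\<close> by walks. A connected \<open>H\<close> above it has no vertex outside
  \<open>V\<close>, and an induced subquiver already contains all arrows between its
  vertices.\<close>

lemma walk_in_quiver_component:
  assumes wf: "wf_digraph Q" and walk: "walk Q x w y"
  shows "\<exists>C. quiver_component C Q \<and> x \<in> verts C \<and> y \<in> verts C"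
proof -
  define V where "V = {v. \<exists>w. walk Q x w v}"
  define C where "C = Q \<restriction> V"
  have x: "x \<in> V" using walk_verts[OF walk wf] walk_Nil[of x Q] by (auto simp: V_def)
  have VQ: "V \<subseteq> verts Q" using walk_verts[OF _ wf] by (auto simp: V_def)
  \<comment> \<open>Since \<open>s\<close> may be an inverse arrow, \<open>V\<close> is closed in
    both directions; a walk that starts in \<open>V\<close> therefore stays in
    \<open>C\<close>.\<close>
  have step: "head (double_quiver Q) s \<in> V"
    if "s \<in> arcs (double_quiver Q)" "tail (double_quiver Q) s \<in> V" for s
    using that walk_append[OF wf] walk_step[OF wf] unfolding V_def by blast
  have wfC: "wf_digraph C" by (auto simp: C_def wf_digraph_def induce_subgraph_def)
  have sub: "subgraph C Q"
    using wf wfC VQ by (auto simp: C_def subgraph_def compatible_def induce_subgraph_def)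
  note dq = subgraph_double_quiver(1,2)[OF sub]
  have arcsC: "s \<in> arcs (double_quiver C)"
    if "s \<in> arcs (double_quiver Q)" "tail (double_quiver Q) s \<in> V" for s
    using step[OF that] that by (cases s) (auto simp: C_def arcs_double induce_subgraph_def split: if_splits)
  have walkC: "walk C u p v" if "walk Q u p v" "u \<in> V" for u p v
    using that
  proof (induction p arbitrary: u)
    case (Cons s p)
    then show ?case using step arcsC by (simp add: walk_Cons[OF wf] walk_Cons[OF wfC] dq)
  qed (simp add: walk_Nil_iff C_def)
  have conn: "Digraph_Component.connected C"
    unfolding connected_iff_walk[OF wfC]
  proof (intro conjI ballI)
    fix u v assume "u \<in> verts C" "v \<in> verts C"
    then obtain p q where "walk Q x p u" "walk Q x q v" by (auto simp: C_def V_def)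
    then show "\<exists>w. walk C u w v"
      using walkC[OF _ x] walk_append[OF wfC] walk_inv_walk[OF wfC] by blast
  qed (use x in \<open>auto simp: C_def\<close>)
  moreover have "H = C" if H: "subgraph C H" "subgraph H Q" "Digraph_Component.connected H" for H
  proof -
    have wfH: "wf_digraph H" using H(1) by (simp add: subgraph_def)
    have "x \<in> verts H" using H(1) x by (auto simp: subgraph_def C_def)
    then have "verts H \<subseteq> V"
      using H(3) walk_subgraph[OF H(2)] unfolding connected_iff_walk[OF wfH] V_def by blast
    then have "verts H = V" "arcs H \<subseteq> arcs C"
      using H wfH by (auto simp: C_def subgraph_def compatible_def induce_subgraph_def wf_digraph_def)
    then show ?thesis using H(1) by (intro pre_digraph.equality) (auto simp: C_def subgraph_def compatible_def)
  qed
  moreover have "y \<in> V" using walk by (auto simp: V_def)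
  ultimately show ?thesis using sub x by (auto simp: pre_digraph.max_subgraph_def C_def)
qed

text \<open>Induction on length: a nonempty closed walk in a tree is not reduced, so it contains a
  backtracking pair, and deleting that pair leaves a shorter closed walk homotopic to it.\<close>

lemma tree_closed_walk_trivial:
  assumes wf: "wf_digraph T" and tree: "quiver_tree T"
  shows "walk T x w x \<Longrightarrow> homotopic T {} x w [] x"
proof (induction w rule: length_induct)
  case (1 w)
  show ?case
  proof (cases "w = []")
    case True
    then show ?thesis using 1(2) by (auto intro: homotopic_refl)
  next
    case False
    then obtain us a d vs where w: "w = us @ [(a, d), (a, \<not> d)] @ vs"
      using tree 1(2) unfolding quiver_tree_def reduced_walk_def by blast
    obtain y where us: "walk T x us y" and rest: "walk T y ((a, d) # (a, \<not> d) # vs) x"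
      using 1(2) by (auto simp: w walk_append_iff[OF wf])
    have arc: "(a, d) \<in> arcs (double_quiver T)" and y: "tail (double_quiver T) (a, d) = y"
      and "walk T (head (double_quiver T) (a, \<not> d)) vs x"
      using rest unfolding walk_Cons[OF wf] by auto
    then have vs: "walk T y vs x" by (cases d) auto
    note b = us walk_step[OF wf arc, unfolded y] vs
    have "homotopic T {} x w (us @ vs) x"
      using homotopic_cancel_middle[OF wf b] by (simp add: w walk_inv_simps)
    moreover have "homotopic T {} x (us @ vs) [] x"
      using 1(1)[rule_format, of "us @ vs"] walk_append[OF wf b(1,3)] by (simp add: w)
    ultimately show ?thesis by (rule homotopic_trans)
  qed
qed

text \<open>The closed walk \<open>walk_inv q @ p\<close> is trivial. Prefixing \<open>q\<close>
  gives a walk homotopic to \<open>q\<close> for this reason, and to \<open>p\<close> by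
  cancellation.\<close>

lemma tree_parallel_walks_homotopic:
  assumes wf: "wf_digraph T" and "quiver_tree T" "walk T x p y" "walk T x q y"
  shows "homotopic T {} x p q y"
proof -
  have "homotopic T {} y (walk_inv q @ p) [] y"
    using assms by (intro tree_closed_walk_trivial) (auto intro: walk_append walk_inv_walk)
  then have "homotopic T {} x (q @ walk_inv q @ p) (q @ []) y"
    using assms(4) by (intro homotopic_concat[where y = y]) (auto intro: homotopic_refl)
  moreover have "homotopic T {} x ([] @ q @ walk_inv q @ p) ([] @ p) y"
    using assms walk_verts[OF assms(3) wf] by (intro homotopic_cancel_middle[where y = x]) (auto intro: walk_Nil)
  ultimately show ?thesis by (auto intro: homotopic_trans homotopic_sym)
qed

section \<open>Monomial ideals\<close>

lemma path_algebra_simps: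
  "carrier (path_algebra Q) = {f. Poly_Mapping.keys f \<subseteq> paths Q}"
  "zero (path_algebra Q) = 0" "add (path_algebra Q) = (+)"
  by (simp_all add: path_algebra_def)

lemma a_inv_path_algebra:
  fixes f :: "('v, 'a) qpath \<Rightarrow>\<^sub>0 'k::field"
  assumes "fin_digraph Q" "Poly_Mapping.keys f \<subseteq> paths Q"
  shows "a_inv (path_algebra Q) f = - f"
proof -
  interpret ring "path_algebra Q :: (('v, 'a) qpath \<Rightarrow>\<^sub>0 'k) ring" by (rule ring_path_algebra) fact
  show ?thesis using assms(2) by (intro minus_equality) (auto simp: path_algebra_simps)
qed

lemma keys_path_mult:
  "Poly_Mapping.keys (path_mult Q f g) \<subseteq>
    {(x, q @ p, z) | x p q y z. (y, p, z) \<in> Poly_Mapping.keys f \<and> (x, q, y) \<in> Poly_Mapping.keys g}"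
  unfolding path_algebra_def monoid.select_convs
  by (intro order.trans[OF keys_sum] UN_least) (auto simp: basis_mult_def split: prod.splits if_splits)

text \<open>Left multiplication prolongs paths at their target (\<open>l\<close>) and right
  multiplication at their source (\<open>r\<close>). Instances of \<open>M\<close> below are the
  paths whose monomials lie in \<open>I\<close>, the nontrivial paths, and the paths starting in a
  given set of vertices.\<close>

lemma ideal_supported:
  fixes M :: "('v, 'a) qpath set"
  assumes fin: "fin_digraph Q"
    and l: "\<And>x p y q z. (x, q, y) \<in> M \<Longrightarrow> (x, q, y) \<in> paths Q \<Longrightarrow> (y, p, z) \<in> paths Q \<Longrightarrow> (x, q @ p, z) \<in> M"
    and r: "\<And>x p y q z. (x, q, y) \<in> paths Q \<Longrightarrow> (y, p, z) \<in> paths Q \<Longrightarrow> (y, p, z) \<in> M \<Longrightarrow> (x, q @ p, z) \<in> M"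
  shows "ideal {f. Poly_Mapping.keys f \<subseteq> paths Q \<inter> M} (path_algebra Q :: (('v, 'a) qpath \<Rightarrow>\<^sub>0 'k::field) ring)"
    (is "ideal ?J ?R")
proof (rule idealI)
  interpret ring ?R by (rule ring_path_algebra) fact
  show "ring ?R" by (rule ring_axioms)
  show "subgroup ?J (add_monoid ?R)"
  proof (rule group.subgroupI[OF add.is_group])
    show "?J \<noteq> {}" by (intro ex_in_conv[THEN iffD1] exI[of _ 0]) simp
    show "inv\<^bsub>add_monoid ?R\<^esub> f \<in> ?J" if "f \<in> ?J" for f
      using that a_inv_path_algebra[OF fin, of f] by (simp add: a_inv_def)
  qed (auto simp: path_algebra_simps dest: subsetD[OF Poly_Mapping.keys_add])
  have wf: "wf_digraph Q" using fin by (simp add: fin_digraph_def)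
  fix f g assume f: "f \<in> ?J" and g: "g \<in> carrier ?R"
  have *: "Poly_Mapping.keys (path_mult Q g f) \<subseteq> paths Q" "Poly_Mapping.keys (path_mult Q f g) \<subseteq> paths Q"
    using f g path_mult_closed[OF wf, of g f] path_mult_closed[OF wf, of f g] by (auto simp: path_algebra_simps)
  have "Poly_Mapping.keys (path_mult Q g f) \<subseteq> M"
  proof
    fix w assume "w \<in> Poly_Mapping.keys (path_mult Q g f)"
    then obtain x p q y z where "w = (x, q @ p, z)"
      "(y, p, z) \<in> Poly_Mapping.keys g" "(x, q, y) \<in> Poly_Mapping.keys f"
      using keys_path_mult[of Q g f] by blast
    moreover have "Poly_Mapping.keys f \<subseteq> paths Q \<inter> M" "Poly_Mapping.keys g \<subseteq> paths Q"
      using f g by (simp_all add: path_algebra_simps)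
    ultimately show "w \<in> M" using l[of x q y p z] by blast
  qed
  then show "g \<otimes>\<^bsub>?R\<^esub> f \<in> ?J" using * by simp
  have "Poly_Mapping.keys (path_mult Q f g) \<subseteq> M"
  proof
    fix w assume "w \<in> Poly_Mapping.keys (path_mult Q f g)"
    then obtain x p q y z where "w = (x, q @ p, z)"
      "(y, p, z) \<in> Poly_Mapping.keys f" "(x, q, y) \<in> Poly_Mapping.keys g"
      using keys_path_mult[of Q f g] by blast
    moreover have "Poly_Mapping.keys f \<subseteq> paths Q \<inter> M" "Poly_Mapping.keys g \<subseteq> paths Q"
      using f g by (simp_all add: path_algebra_simps)
    ultimately show "w \<in> M" using r[of x q y p z] by blast
  qed
  then show "f \<otimes>\<^bsub>?R\<^esub> g \<in> ?J" using * by simp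
qed

text \<open>The path algebra is formalised as a ring without scalars, so scaling is done by left
  multiplication with \<open>c\<close> times the trivial path at the target.\<close>

lemma ideal_single_scale:
  assumes wf: "wf_digraph Q" and I: "ideal I (path_algebra Q)" and one: "Poly_Mapping.single u (1::'k::field) \<in> I"
  shows "Poly_Mapping.single u (c::'k) \<in> I"
proof -
  interpret ideal I "path_algebra Q" by fact
  obtain x p y where u: "u = (x, p, y)" by (cases u)
  have "u \<in> paths Q" using one Icarr[of "Poly_Mapping.single u 1"] by (auto simp: path_algebra_simps)
  then have "(y, [], y) \<in> paths Q"
    using wf_digraph.awalk_last_in_verts[OF wf, of x p y] wf_digraph.awalk_Nil_iff[OF wf, of y y]
    by (auto simp: u paths_def wf_digraph.awalk_ends[OF wf])
  then have "path_mult Q (Poly_Mapping.single (y, [], y) c) (Poly_Mapping.single u 1) \<in> I"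
    by (intro I_l_closed one) (auto simp: path_algebra_simps)
  then show ?thesis by (simp add: path_mult_single basis_mult_def u)
qed

text \<open>The elements all of whose paths lie in \<open>I\<close> form an ideal. It contains the
  generating paths, hence all of \<open>I\<close>.\<close>

lemma monomial_ideal_component:
  fixes I :: "(('v, 'a) qpath \<Rightarrow>\<^sub>0 'k::field) set"
  assumes mono: "monomial_presentation Q I" and f: "f \<in> I" "u \<in> Poly_Mapping.keys f"
  shows "Poly_Mapping.single u c \<in> I"
proof -
  let ?R = "path_algebra Q :: (('v, 'a) qpath \<Rightarrow>\<^sub>0 'k) ring"
  obtain P where fin: "fin_digraph Q" and I: "ideal I ?R"
    and P: "P \<subseteq> paths Q" "I = genideal ?R ((\<lambda>p. Poly_Mapping.single p 1) ` P)"
    using mono by (auto simp: monomial_presentation_def admissible_ideal_def)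
  interpret ring ?R by (rule ring_path_algebra) fact
  let ?M = "{u. Poly_Mapping.single u (1::'k) \<in> I}"
  have J: "ideal {f. Poly_Mapping.keys f \<subseteq> paths Q \<inter> ?M} ?R"
  proof (rule ideal_supported[OF fin])
    fix x p y q z
    show "(x, q @ p, z) \<in> ?M"
      if "(x, q, y) \<in> ?M" "(y, p, z) \<in> paths Q"
      using ideal.I_l_closed[OF I, of "Poly_Mapping.single (x, q, y) 1" "Poly_Mapping.single (y, p, z) 1"] that
      by (simp add: path_mult_single basis_mult_def path_algebra_simps)
    show "(x, q @ p, z) \<in> ?M"
      if "(x, q, y) \<in> paths Q" "(y, p, z) \<in> ?M"
      using ideal.I_r_closed[OF I, of "Poly_Mapping.single (y, p, z) 1" "Poly_Mapping.single (x, q, y) 1"] that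
      by (simp add: path_mult_single basis_mult_def path_algebra_simps)
  qed
  have "(\<lambda>p. Poly_Mapping.single p 1) ` P \<subseteq> I"
    unfolding P(2) using P(1) by (intro genideal_self) (auto simp: path_algebra_simps)
  then have "I \<subseteq> {f. Poly_Mapping.keys f \<subseteq> paths Q \<inter> ?M}"
    using P(1) unfolding P(2) by (intro genideal_minimal J[unfolded P(2)]) auto
  then have "Poly_Mapping.single u 1 \<in> I" using f by auto
  then show ?thesis using ideal_single_scale[OF _ I] fin by (simp add: fin_digraph_def)
qed

text \<open>Each single term of a relation in a monomial ideal lies in the ideal again. By
  minimality this nonzero term is the whole relation, which therefore involves only one
  path.\<close>

lemma monomial_minimally_related:
  fixes I :: "(('v, 'a) qpath \<Rightarrow>\<^sub>0 'k::field) set"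
  assumes "monomial_presentation Q I"
  shows "minimally_related I \<subseteq> Id"
proof (clarsimp simp: minimally_related_def)
  fix r :: "('v, 'a) qpath \<Rightarrow>\<^sub>0 'k" and x y x' y' :: 'v and p p' :: "'a list"
  let ?u = "(x, p, y)"
  assume r: "minimal_relation I r" and u: "?u \<in> Poly_Mapping.keys r" "(x', p', y') \<in> Poly_Mapping.keys r"
  let ?s = "Poly_Mapping.single ?u (Poly_Mapping.lookup r ?u)"
  have "?s \<in> I" using monomial_ideal_component[OF assms _ u(1)] r by (simp add: minimal_relation_def)
  moreover have "?s \<noteq> 0" using u(1) by (metis in_keys_iff lookup_single_eq lookup_zero)
  moreover have "\<forall>u \<in> Poly_Mapping.keys ?s. Poly_Mapping.lookup ?s u = Poly_Mapping.lookup r u"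
    using u(1) by (auto simp: in_keys_iff lookup_single split: if_splits)
  ultimately have "?s = r" using r unfolding minimal_relation_def by blast
  then show "x = x' \<and> p = p' \<and> y = y'" using u(2) by (metis Pair_inject keys_single singletonD empty_iff)
qed

section \<open>A connected algebra has a connected quiver\<close>

text \<open>An admissible ideal lies in the arrow ideal, whose elements only involve paths of
  positive length.\<close>

lemma admissible_ideal_no_vertex:
  fixes I :: "(('v, 'a) qpath \<Rightarrow>\<^sub>0 'k::field) set"
  assumes fin: "fin_digraph Q" and adm: "admissible_ideal Q I"
  shows "Poly_Mapping.single (x, [], x) 1 \<notin> I"
proof
  assume *: "Poly_Mapping.single (x, [], x) 1 \<in> I"
  let ?R = "path_algebra Q :: (('v, 'a) qpath \<Rightarrow>\<^sub>0 'k) ring"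
  interpret ring ?R by (rule ring_path_algebra) fact
  interpret Q: fin_digraph Q by fact
  let ?g = "(\<lambda>a. Poly_Mapping.single (tail Q a, [a], head Q a) (1::'k)) ` arcs Q"
  let ?M = "{(x, p, y). p \<noteq> []} :: ('v, 'a) qpath set"
  have arcs: "(tail Q a, [a], head Q a) \<in> paths Q" if "a \<in> arcs Q" for a
    using that by (auto simp: paths_def intro: Q.arc_implies_awalk)
  have J: "ideal (arrow_ideal Q) ?R"
    unfolding arrow_ideal_def using arcs by (intro genideal_ideal) (auto simp: path_algebra_simps)
  have M: "ideal {f. Poly_Mapping.keys f \<subseteq> paths Q \<inter> ?M} ?R" by (rule ideal_supported[OF fin]) auto
  have "arrow_ideal Q \<subseteq> {f :: _ \<Rightarrow>\<^sub>0 'k. Poly_Mapping.keys f \<subseteq> paths Q \<inter> ?M}"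
    unfolding arrow_ideal_def using arcs by (intro genideal_minimal M) auto
  \<comment> \<open>\<open>ideal_power\<close> starts from the whole ring, so the second power
    unfolds to a product whose last factor is the arrow ideal.\<close>
  moreover have "ideal_power ?R (arrow_ideal Q) 2 \<subseteq> arrow_ideal Q"
  proof -
    have K: "ideal (ideal_prod ?R (carrier ?R) (arrow_ideal Q)) ?R"
      by (intro ideal_prod_is_ideal oneideal J)
    show ?thesis
      using ideal_prod_inter[OF K J] by (simp add: ideal_power_def numeral_2_eq_2)
  qed
  moreover have "I \<subseteq> ideal_power ?R (arrow_ideal Q) 2" using adm by (simp add: admissible_ideal_def)
  ultimately have "Poly_Mapping.keys (Poly_Mapping.single (x, [] :: 'a list, x) (1::'k)) \<subseteq> ?M" using * by blast
  then show False by simp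
qed

text \<open>If \<open>v'\<close> were not reachable, the paths starting in the set \<open>V\<close>
  of vertices reachable from \<open>v\<close> and the remaining paths would span two ideals of the
  path algebra. Their images in the quotient would be nonzero complementary ideals, contradicting
  connectedness.\<close>

lemma connected_algebra_walk:
  fixes I :: "(('v, 'a) qpath \<Rightarrow>\<^sub>0 'k::field) set"
  assumes mono: "monomial_presentation Q I"
    and conn: "connected_algebra (bound_quiver_algebra Q I)"
    and v: "v \<in> verts Q" "v' \<in> verts Q"
  shows "\<exists>w. walk Q v w v'"
proof (rule ccontr)
  assume no_walk: "\<nexists>w. walk Q v w v'"
  let ?R = "path_algebra Q :: (('v, 'a) qpath \<Rightarrow>\<^sub>0 'k) ring"
  have fin: "fin_digraph Q" and adm: "admissible_ideal Q I" and I: "ideal I ?R"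
    using mono by (auto simp: monomial_presentation_def admissible_ideal_def)
  interpret Q: fin_digraph Q by fact
  interpret I: ideal I ?R by fact
  define V where "V = {y. \<exists>w. walk Q v w y}"
  have V: "v \<in> V" "v' \<notin> V" using no_walk walk_Nil[OF v(1)] by (auto simp: V_def)
  \<comment> \<open>A path is a walk and can be run backwards, so it cannot cross the boundary of
    \<open>V\<close>. This is what makes \<open>J V\<close> and \<open>J (- V)\<close>
    two-sided.\<close>
  have end_V: "y \<in> V \<longleftrightarrow> x \<in> V" if "(x, p, y) \<in> paths Q" for x p y
    using that walk_append[OF Q.wf_digraph_axioms] awalk_path_walk[OF Q.wf_digraph_axioms]
      walk_inv_walk[OF Q.wf_digraph_axioms]
    unfolding V_def paths_def by blast
  define J where "J W = {f :: ('v, 'a) qpath \<Rightarrow>\<^sub>0 'k. Poly_Mapping.keys f \<subseteq> paths Q \<inter> {(x, p, y). x \<in> W}}" for W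
  have J: "ideal (J V) ?R" "ideal (J (- V)) ?R"
    unfolding J_def by (rule ideal_supported[OF fin]; auto dest: end_V)+
  have proj: "ideal ((+>\<^bsub>?R\<^esub>) I ` J V) (?R Quot I)" "ideal ((+>\<^bsub>?R\<^esub>) I ` J (- V)) (?R Quot I)"
    by (intro I.ring_ideal_imp_quot_ideal I J)+
  have zero: "\<zero>\<^bsub>?R Quot I\<^esub> = I" by (simp add: FactRing_def)
  have J_carrier: "J W \<subseteq> carrier ?R" for W by (auto simp: J_def path_algebra_simps)
  have split: "\<exists>g\<in>J V. \<exists>h\<in>J (- V). f = g + h" if f: "f \<in> carrier ?R" for f
  proof -
    let ?s = "\<lambda>u. Poly_Mapping.single u (Poly_Mapping.lookup f u)"
    let ?A = "\<lambda>W. {u \<in> Poly_Mapping.keys f. fst u \<in> W}"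
    have "sum ?s (?A W) \<in> J W" for W
    proof -
      have "Poly_Mapping.keys (sum ?s (?A W)) \<subseteq> paths Q \<inter> {(x, p, y). x \<in> W}"
        by (rule order.trans[OF keys_sum]) (use f in \<open>auto simp: path_algebra_simps split: if_splits\<close>)
      then show ?thesis by (simp add: J_def)
    qed
    moreover have "f = sum ?s (?A V) + sum ?s (?A (- V))"
    proof -
      have "sum ?s (?A V) + sum ?s (?A (- V)) = sum ?s (?A V \<union> ?A (- V))"
        by (rule sum.union_disjoint[symmetric]) auto
      also have "?A V \<union> ?A (- V) = Poly_Mapping.keys f" by auto
      finally show ?thesis by (simp flip: poly_mapping_expand)
    qed
    ultimately show ?thesis by blast
  qed
  have coset_add: "(I +>\<^bsub>?R\<^esub> g) \<oplus>\<^bsub>?R Quot I\<^esub> (I +>\<^bsub>?R\<^esub> h) = I +>\<^bsub>?R\<^esub> (g + h)"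
    if "g \<in> carrier ?R" "h \<in> carrier ?R" for g h
    using I.a_rcos_sum[OF that] by (simp add: FactRing_def path_algebra_simps)
  have carr: "carrier (?R Quot I) = (+>\<^bsub>?R\<^esub>) I ` carrier ?R"
    by (auto simp: FactRing_def A_RCOSETS_def')
  have sum: "(+>\<^bsub>?R\<^esub>) I ` J V <+>\<^bsub>?R Quot I\<^esub> (+>\<^bsub>?R\<^esub>) I ` J (- V) = carrier (?R Quot I)"
  proof
    show "(+>\<^bsub>?R\<^esub>) I ` J V <+>\<^bsub>?R Quot I\<^esub> (+>\<^bsub>?R\<^esub>) I ` J (- V) \<subseteq> carrier (?R Quot I)"
    proof (clarsimp simp: set_add_def')
      fix g h assume "g \<in> J V" "h \<in> J (- V)"
      then have gh: "g \<in> carrier ?R" "h \<in> carrier ?R" using J_carrier by blast+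
      then have "g + h \<in> carrier ?R" using I.add.m_closed[OF gh] by (simp add: path_algebra_simps(3))
      then show "(I +>\<^bsub>?R\<^esub> g) \<oplus>\<^bsub>?R Quot I\<^esub> (I +>\<^bsub>?R\<^esub> h) \<in> carrier (?R Quot I)"
        unfolding coset_add[OF gh] carr by blast
    qed
    show "carrier (?R Quot I) \<subseteq> (+>\<^bsub>?R\<^esub>) I ` J V <+>\<^bsub>?R Quot I\<^esub> (+>\<^bsub>?R\<^esub>) I ` J (- V)"
    proof
      fix X assume "X \<in> carrier (?R Quot I)"
      then obtain f where f: "f \<in> carrier ?R" "X = I +>\<^bsub>?R\<^esub> f" unfolding carr by blast
      obtain g h where gh: "g \<in> J V" "h \<in> J (- V)" "f = g + h" using split[OF f(1)] by blast
      have "X = (I +>\<^bsub>?R\<^esub> g) \<oplus>\<^bsub>?R Quot I\<^esub> (I +>\<^bsub>?R\<^esub> h)"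
        using coset_add[of g h] gh f(2) J_carrier by blast
      then show "X \<in> (+>\<^bsub>?R\<^esub>) I ` J V <+>\<^bsub>?R Quot I\<^esub> (+>\<^bsub>?R\<^esub>) I ` J (- V)"
        unfolding set_add_def' using gh(1,2) by blast
    qed
  qed
  have sum_closed: "(\<Sum>i\<in>A. F i) \<in> I" if "\<And>i. i \<in> A \<Longrightarrow> F i \<in> I" for A and F :: "('v, 'a) qpath \<Rightarrow> _"
    using that
  proof (induction A rule: infinite_finite_induct)
    case (insert u A)
    then show ?case using additive_subgroup.a_closed[OF ideal.axioms(1)[OF I], of "F u" "sum F A"] by (simp add: path_algebra_simps)
  qed (use additive_subgroup.zero_closed[OF ideal.axioms(1)[OF I]] in \<open>simp_all add: path_algebra_simps\<close>)
  have inter: "(+>\<^bsub>?R\<^esub>) I ` J V \<inter> (+>\<^bsub>?R\<^esub>) I ` J (- V) = {\<zero>\<^bsub>?R Quot I\<^esub>}"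
  proof
    show "(+>\<^bsub>?R\<^esub>) I ` J V \<inter> (+>\<^bsub>?R\<^esub>) I ` J (- V) \<subseteq> {\<zero>\<^bsub>?R Quot I\<^esub>}"
    proof
      fix X assume "X \<in> (+>\<^bsub>?R\<^esub>) I ` J V \<inter> (+>\<^bsub>?R\<^esub>) I ` J (- V)"
      then obtain g h where gh: "g \<in> J V" "h \<in> J (- V)" "X = I +>\<^bsub>?R\<^esub> g" "X = I +>\<^bsub>?R\<^esub> h" by blast
      have g: "g \<in> carrier ?R" and h: "h \<in> carrier ?R" using gh J_carrier by blast+
      have "g \<in> I +>\<^bsub>?R\<^esub> h" using I.a_rcos_self[OF g] gh(3,4) by simp
      then obtain i where i: "i \<in> I" "g = i + h" by (auto simp: a_r_coset_def' path_algebra_simps)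
      \<comment> \<open>The supports of \<open>g\<close> and \<open>h\<close> are disjoint, so each
        term of \<open>g\<close> is a term of \<open>i\<close>. As \<open>I\<close> is monomial, all
        these terms, and hence \<open>g\<close>, lie in \<open>I\<close>.\<close>
      have "u \<in> Poly_Mapping.keys i" "Poly_Mapping.lookup g u = Poly_Mapping.lookup i u"
        if u: "u \<in> Poly_Mapping.keys g" for u
      proof -
        have "u \<notin> Poly_Mapping.keys h" using u gh(1,2) by (auto simp: J_def)
        then show "Poly_Mapping.lookup g u = Poly_Mapping.lookup i u"
          by (simp add: i(2) lookup_add in_keys_iff)
        then show "u \<in> Poly_Mapping.keys i" using u by (simp add: in_keys_iff)
      qed
      then have "(\<Sum>u\<in>Poly_Mapping.keys g. Poly_Mapping.single u (Poly_Mapping.lookup g u)) \<in> I"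
        by (intro sum_closed monomial_ideal_component[OF mono i(1)])
      then have "g \<in> I" by (simp flip: poly_mapping_expand)
      then show "X \<in> {\<zero>\<^bsub>?R Quot I\<^esub>}" using I.a_rcos_const by (simp add: gh(3) zero)
    qed
    show "{\<zero>\<^bsub>?R Quot I\<^esub>} \<subseteq> (+>\<^bsub>?R\<^esub>) I ` J V \<inter> (+>\<^bsub>?R\<^esub>) I ` J (- V)"
      using additive_subgroup.zero_closed[OF ideal.axioms(1)[OF proj(1)]]
        additive_subgroup.zero_closed[OF ideal.axioms(1)[OF proj(2)]] by blast
  qed
  \<comment> \<open>The trivial path at a vertex of \<open>W\<close> survives in the
    quotient.\<close>
  have nonzero: "(+>\<^bsub>?R\<^esub>) I ` J W \<noteq> {\<zero>\<^bsub>?R Quot I\<^esub>}" if x: "x \<in> W" "x \<in> verts Q" for x W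
  proof
    assume *: "(+>\<^bsub>?R\<^esub>) I ` J W = {\<zero>\<^bsub>?R Quot I\<^esub>}"
    let ?e = "Poly_Mapping.single (x, [], x) 1 :: ('v, 'a) qpath \<Rightarrow>\<^sub>0 'k"
    have e: "?e \<in> J W" using x by (simp add: J_def paths_def Q.awalk_Nil_iff)
    then have "I +>\<^bsub>?R\<^esub> ?e = I" using * by (auto simp: zero)
    then have "?e \<in> I" using I.a_rcos_self[of ?e] J_carrier e by blast
    then show False using admissible_ideal_no_vertex[OF fin adm] by blast
  qed
  show False
    using conn proj sum inter nonzero[OF V(1) v(1)] nonzero[of v' "- V"] V(2) v(2)
    unfolding connected_algebra_def by blast
qed

section \<open>Homomorphisms of walk groups\<close>

text \<open>All elements of the class \<open>U\<close> contribute the same coset once \<open>g\<close> respects homotopy.\<close>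

definition walk_group_map ::
    "(('a \<times> bool) list \<Rightarrow> ('b \<times> bool) list) \<Rightarrow> ('w, 'b) pre_digraph \<Rightarrow>
     (('w, 'b) qpath \<times> ('w, 'b) qpath) set \<Rightarrow> 'w \<Rightarrow> ('a \<times> bool) list set \<Rightarrow> ('b \<times> bool) list set" where
  "walk_group_map g R S y U = (\<Union>u\<in>U. homotopy R S y `` {g u})"

lemma walk_group_map_class:
  assumes wf: "wf_digraph Q" "wf_digraph R"
    and hom: "\<And>v w. homotopic Q S x v w x \<Longrightarrow> homotopic R S' y (g v) (g w) y"
    and w: "walk Q x w x"
  shows "walk_group_map g R S' y (homotopy Q S x `` {w}) = homotopy R S' y `` {g w}"
proof -
  have "homotopy R S' y `` {g u} = homotopy R S' y `` {g w}" if "u \<in> homotopy Q S x `` {w}" for u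
    using that hom homotopic_sym[of Q S x w u x] by (intro equiv_class_eq[OF equiv_homotopy[OF wf(2)]]) (auto simp: homotopy_def)
  moreover have "w \<in> homotopy Q S x `` {w}" using w by (auto simp: homotopy_def intro: homotopic_refl)
  ultimately show ?thesis unfolding walk_group_map_def by blast
qed

text \<open>Compatibility with concatenation is required only up to homotopy, because a change of
  base point inserts a detour between the two factors.\<close>

lemma walk_group_map_hom:
  assumes wf: "wf_digraph Q" "wf_digraph R"
    and hom: "\<And>v w. homotopic Q S x v w x \<Longrightarrow> homotopic R S' y (g v) (g w) y"
    and app: "\<And>v w. walk Q x v x \<Longrightarrow> walk Q x w x \<Longrightarrow> homotopic R S' y (g (v @ w)) (g v @ g w) y"
  shows "walk_group_map g R S' y \<in> Group.hom (walk_group Q S x) (walk_group R S' y)"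
proof (rule homI)
  note cls = walk_group_map_class[OF wf hom]
  have walk: "walk R y (g w) y" if "walk Q x w x" for w
    using homotopic_walks[OF wf(2) hom[OF homotopic_refl[OF that]]] by blast
  show "walk_group_map g R S' y U \<in> carrier (walk_group R S' y)"
    if "U \<in> carrier (walk_group Q S x)" for U
    using that walk by (auto simp: walk_group_carrier cls)
  fix U V assume "U \<in> carrier (walk_group Q S x)" "V \<in> carrier (walk_group Q S x)"
  then obtain u v where u: "U = homotopy Q S x `` {u}" "walk Q x u x"
    and v: "V = homotopy Q S x `` {v}" "walk Q x v x" by (auto simp: walk_group_carrier)
  have "homotopy R S' y `` {g (v @ u)} = homotopy R S' y `` {g v @ g u}"
    using app[OF v(2) u(2)] by (intro equiv_class_eq[OF equiv_homotopy[OF wf(2)]]) (simp add: homotopy_def)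
  then show "walk_group_map g R S' y (U \<otimes>\<^bsub>walk_group Q S x\<^esub> V) =
      walk_group_map g R S' y U \<otimes>\<^bsub>walk_group R S' y\<^esub> walk_group_map g R S' y V"
    using walk_append[OF wf(1) v(2) u(2)]
    by (simp add: u v walk_group_mult[OF wf(1)] walk_group_mult[OF wf(2)] walk cls)
qed

text \<open>Conjugation by \<open>p\<close> is inverted, up to homotopy, by conjugation with
  \<open>walk_inv p\<close>.\<close>

lemma walk_group_basepoint_iso:
  assumes wf: "wf_digraph Q" and p: "walk Q x p y"
  shows "walk_group Q S x \<cong> walk_group Q S y"
proof -
  define g where "g w = walk_inv p @ w @ p" for w
  have p': "walk Q y (walk_inv p) x" by (rule walk_inv_walk[OF wf p])
  note app = walk_append[OF wf]
  have walk: "walk Q y (g w) y" if "walk Q x w x" for w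
    unfolding g_def by (intro app[OF p'] app[OF that] p)
  have hom: "homotopic Q S y (g v) (g w) y" if "homotopic Q S x v w x" for v w
    unfolding g_def by (intro homotopic_concat[where y = x] homotopic_refl p p' that)
  have "walk_group_map g Q S y \<in> Group.hom (walk_group Q S x) (walk_group Q S y)"
  proof (rule walk_group_map_hom[OF wf wf hom])
    fix v w assume "walk Q x v x" "walk Q x w x"
    then have "homotopic Q S y ((walk_inv p @ v) @ p @ walk_inv p @ (w @ p)) ((walk_inv p @ v) @ (w @ p)) y"
      using p p' app by (intro homotopic_cancel_middle[OF wf, where y = x and y' = y]) blast+
    then show "homotopic Q S y (g (v @ w)) (g v @ g w) y" by (auto simp: g_def intro: homotopic_sym)
  qed
  moreover have "inj_on (walk_group_map g Q S y) (carrier (walk_group Q S x))"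
  proof (rule inj_onI)
    \<comment> \<open>Conjugating back recovers \<open>u\<close>, which gives injectivity.\<close>
    have ret: "homotopic Q S x (p @ g u @ walk_inv p) u x" if u: "walk Q x u x" for u
    proof -
      have "homotopic Q S x ([] @ p @ walk_inv p @ (u @ p @ walk_inv p)) ([] @ (u @ p @ walk_inv p)) x"
        using p p' app u walk_verts[OF u wf]
        by (intro homotopic_cancel_middle[OF wf, where y = x and y' = y]) (blast intro: walk_Nil)+
      moreover have "homotopic Q S x (u @ p @ walk_inv p @ []) (u @ []) x"
        using p u walk_verts[OF u wf]
        by (intro homotopic_cancel_middle[OF wf, where y = x and y' = y]) (blast intro: walk_Nil)+
      ultimately show ?thesis by (auto simp: g_def intro: homotopic_trans)
    qed
    fix U V assume UV: "U \<in> carrier (walk_group Q S x)" "V \<in> carrier (walk_group Q S x)"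
      and eq: "walk_group_map g Q S y U = walk_group_map g Q S y V"
    then obtain u v where u: "U = homotopy Q S x `` {u}" "walk Q x u x"
      and v: "V = homotopy Q S x `` {v}" "walk Q x v x" by (auto simp: walk_group_carrier)
    have "homotopic Q S y (g u) (g v) y"
      using eq by (simp add: u v walk_group_map_class[OF wf wf hom] homotopy_class_eq_iff[OF wf] walk)
    then have "homotopic Q S x (p @ g u @ walk_inv p) (p @ g v @ walk_inv p) x"
      by (intro homotopic_concat[where y = y] homotopic_refl p p')
    then have "homotopic Q S x u v x"
      using ret[OF u(2)] ret[OF v(2)] by (blast intro: homotopic_trans homotopic_sym)
    then show "U = V" using u v by (simp add: homotopy_class_eq_iff[OF wf])
  qed
  moreover have "carrier (walk_group Q S y) \<subseteq> walk_group_map g Q S y ` carrier (walk_group Q S x)"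
  proof
    fix V assume "V \<in> carrier (walk_group Q S y)"
    then obtain v where v: "V = homotopy Q S y `` {v}" "walk Q y v y" by (auto simp: walk_group_carrier)
    let ?w = "p @ v @ walk_inv p"
    have w: "walk Q x ?w x" using p p' v(2) app by blast
    have "homotopic Q S y ([] @ walk_inv p @ walk_inv (walk_inv p) @ (v @ walk_inv p @ p)) ([] @ (v @ walk_inv p @ p)) y"
      using p p' v(2) app walk_verts[OF v(2) wf]
      by (intro homotopic_cancel_middle[OF wf, where y = y and y' = x]) (blast intro: walk_Nil)+
    moreover have "homotopic Q S y (v @ walk_inv p @ walk_inv (walk_inv p) @ []) (v @ []) y"
      using p' v(2) walk_verts[OF v(2) wf]
      by (intro homotopic_cancel_middle[OF wf, where y = y and y' = x]) (blast intro: walk_Nil)+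
    ultimately have "homotopic Q S y (g ?w) v y"
      by (auto simp: g_def walk_inv_simps intro: homotopic_trans)
    then have "V = walk_group_map g Q S y (homotopy Q S x `` {?w})"
      using v walk[OF w] by (simp add: walk_group_map_class[OF wf wf hom w] homotopy_class_eq_iff[OF wf] homotopic_sym)
    then show "V \<in> walk_group_map g Q S y ` carrier (walk_group Q S x)"
      using w by (auto simp: walk_group_carrier)
  qed
  ultimately show ?thesis
    unfolding is_iso_def iso_def bij_betw_def Group.hom_def by blast
qed

section \<open>Substituting walks for arrows\<close>

text \<open>When each \<open>f a\<close> is parallel to \<open>a\<close>, this is, on homotopy
  classes, the functor of fundamental groupoids determined by its values on arrows.\<close>

definition walk_subst :: "('a \<Rightarrow> ('b \<times> bool) list) \<Rightarrow> ('a \<times> bool) list \<Rightarrow> ('b \<times> bool) list" where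
  "walk_subst f w = concat (map (\<lambda>(a, d). if d then f a else walk_inv (f a)) w)"

lemma walk_subst_simps [simp]:
  "walk_subst f [] = []"
  "walk_subst f ((a, d) # w) = (if d then f a else walk_inv (f a)) @ walk_subst f w"
  "walk_subst f (v @ w) = walk_subst f v @ walk_subst f w"
  by (auto simp: walk_subst_def)

lemma walk_subst_inv: "walk_subst f (walk_inv w) = walk_inv (walk_subst f w)"
  by (induction w) (auto simp: walk_inv_simps)

lemma walk_subst_walk:
  assumes wf: "wf_digraph Q" "wf_digraph R" and verts: "verts Q \<subseteq> verts R"
    and f: "\<And>a. a \<in> arcs Q \<Longrightarrow> walk R (tail Q a) (f a) (head Q a)"
  shows "walk Q x w y \<Longrightarrow> walk R x (walk_subst f w) y"
proof (induction w arbitrary: x)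
  case Nil
  then show ?case using verts by (auto simp: walk_Nil_iff)
next
  case (Cons s w)
  obtain a d where s: "s = (a, d)" by (cases s)
  have a: "a \<in> arcs Q" "tail (double_quiver Q) s = x" "walk Q (head (double_quiver Q) s) w y"
    using Cons.prems by (auto simp: s walk_Cons[OF wf(1)] arcs_double)
  have "walk R x (if d then f a else walk_inv (f a)) (head (double_quiver Q) s)"
    using f[OF a(1)] walk_inv_walk[OF wf(2) f[OF a(1)]] a(2) by (auto simp: s)
  from walk_append[OF wf(2) this Cons.IH[OF a(3)]] show ?case by (simp add: s)
qed

text \<open>Only the two cancellation rules need checking: they become a walk followed by its
  inverse, with \<open>f a\<close> or its inverse in front.\<close>

lemma walk_subst_homotopic:
  assumes wf: "wf_digraph Q" "wf_digraph R" and verts: "verts Q \<subseteq> verts R"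
    and f: "\<And>a. a \<in> arcs Q \<Longrightarrow> walk R (tail Q a) (f a) (head Q a)"
    and "homotopic Q {} x v w y"
  shows "homotopic R {} x (walk_subst f v) (walk_subst f w) y"
  using assms(5)
proof (induction rule: homotopic.induct)
  case (homotopic_refl x w y)
  then show ?case by (intro homotopic.homotopic_refl walk_subst_walk[OF wf verts f])
next
  case (homotopic_cancel_source a)
  then show ?case using homotopic_cancel[OF wf(2) f] by simp
next
  case (homotopic_cancel_target a)
  then show ?case using homotopic_cancel[OF wf(2) walk_inv_walk[OF wf(2) f]] by (simp add: walk_inv_simps)
qed (auto intro: homotopic.intros)

section \<open>The quotient by the subquiver subgroup\<close>

text \<open>For closed \<open>w\<close> and empty \<open>v\<close> this says that substitution does
  not change \<open>w\<close> modulo the subgroup. The walk telescopes: the first step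
  \<open>s\<close> and its substitute \<open>p\<close> contribute
  \<open>v @ [s] @ walk_inv p @ walk_inv v\<close>, and the remainder is the same statement with
  \<open>v\<close> extended by \<open>s\<close>. This is why \<open>v\<close> must be arbitrary in
  the induction.\<close>

lemma walk_subst_class_in_subquiver_subgroup:
  assumes sub: "subgraph QB QA"
    and f: "\<And>a. a \<in> arcs QA \<Longrightarrow> f a = [(a, True)] \<or> a \<in> arcs QB \<and> walk QB (tail QB a) (f a) (head QB a)"
  shows "walk QA x w y \<Longrightarrow> walk QA z v x \<Longrightarrow>
    homotopy QA (minimally_related IA) z `` {v @ w @ walk_inv (walk_subst f w) @ walk_inv v}
      \<in> subquiver_subgroup QA IA QB z"
proof (induction w arbitrary: x v)
  case v: Nil
  have wf: "wf_digraph QA" and z: "z \<in> verts QA"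
    using sub walk_verts[OF v(2)] by (auto simp: subgraph_def)
  interpret N: normal "subquiver_subgroup QA IA QB z" "fundamental_group QA IA z"
    by (rule normal_subquiver_subgroup[OF sub z])
  have "homotopy QA (minimally_related IA) z `` {v @ walk_inv v} = one (fundamental_group QA IA z)"
    unfolding fundamental_group_def walk_group_one using walk_inv_walk[OF wf v(2)] v(2) walk_append[OF wf]
    by (subst homotopy_class_eq_iff[OF wf]) (auto intro: homotopic_cancel[OF wf] walk_Nil z)
  then show ?case using N.one_closed by (simp add: walk_inv_simps)
next
  case (Cons s w)
  let ?h = "homotopy QA (minimally_related IA) z" and ?N = "subquiver_subgroup QA IA QB z"
  note v = Cons.prems(2)
  have wf: "wf_digraph QA" "wf_digraph QB" and z: "z \<in> verts QA"
    using sub walk_verts[OF v] by (auto simp: subgraph_def)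
  interpret N: normal ?N "fundamental_group QA IA z"
    by (rule normal_subquiver_subgroup[OF sub z])
  obtain a d where s: "s = (a, d)" by (cases s)
  define x' where "x' = head (double_quiver QA) s"
  have a: "a \<in> arcs QA" and step: "walk QA x [s] x'" and w: "walk QA x' w y"
    using Cons.prems(1) walk_step[OF wf(1), of s]
    by (auto simp: walk_Cons[OF wf(1)] x'_def s arcs_double walk_Nil_iff)
  have th: "tail QB = tail QA" "head QB = head QA" using sub by (auto simp: subgraph_def compatible_def)
  have f_walk: "walk QA (tail QA b) (f b) (head QA b)" if "b \<in> arcs QA" for b
    using f[OF that] walk_arc[OF wf(1) that] walk_subgraph[OF sub, of "tail QA b" "f b" "head QA b"] by (auto simp: th)
  note subst_walk = walk_subst_walk[OF wf(1) wf(1) order.refl f_walk]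
  define p where "p = walk_subst f [s]"
  have p: "walk QA x p x'" unfolding p_def by (rule subst_walk[OF _ step])
  note app = walk_append[OF wf(1)] and inv = walk_inv_walk[OF wf(1)]
  let ?g = "v @ [s] @ walk_inv p @ walk_inv v"
  let ?r = "(v @ [s]) @ w @ walk_inv (walk_subst f w) @ walk_inv (v @ [s])"
  note vs = app[OF v step] and inv_subst = inv[OF subst_walk[OF _ w]] and inv_pv = app[OF inv[OF p] inv[OF v]]
  have g: "walk QA z ?g z" by (rule app[OF v app[OF step inv_pv]])
  have r: "walk QA z ?r z" by (rule app[OF vs app[OF w app[OF inv_subst inv[OF vs]]]])
  \<comment> \<open>Either the arrow is fixed, \<open>p\<close> is \<open>[s]\<close> and the walk
    is a mere detour, or \<open>[s]\<close> and \<open>p\<close> are parallel walks in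
    \<open>QB\<close> and the class is a generator.\<close>
  have "?h `` {?g} \<in> ?N"
  proof (cases "f a = [(a, True)]")
    case True
    then have p_eq: "p = [s]" by (auto simp: p_def s walk_inv_simps)
    have "homotopic QA (minimally_related IA) z ((v @ [s]) @ walk_inv (v @ [s])) [] z"
      by (rule homotopic_cancel[OF wf(1) vs])
    then have "?h `` {?g} = one (fundamental_group QA IA z)"
      unfolding fundamental_group_def walk_group_one
      by (subst homotopy_class_eq_iff[OF wf(1) g walk_Nil[OF z]]) (simp add: p_eq walk_inv_simps)
    then show ?thesis using N.one_closed by simp
  next
    case False
    then have aB: "a \<in> arcs QB" "walk QB (tail QB a) (f a) (head QB a)" using f[OF a] by auto
    have "tail (double_quiver QB) s = x"
      using Cons.prems(1) by (simp add: walk_Cons[OF wf(1)] subgraph_double_quiver[OF sub])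
    then have "walk QB x [s] x'"
      using walk_step[OF wf(2), of s] aB(1) by (simp add: s arcs_double x'_def subgraph_double_quiver[OF sub])
    moreover have "walk QB x p x'"
      using aB(2) walk_inv_walk[OF wf(2) aB(2)] \<open>tail (double_quiver QB) s = x\<close>
      by (auto simp: p_def s x'_def th)
    ultimately show ?thesis
      unfolding subquiver_subgroup_def using v by (intro generate.incl) blast
  qed
  moreover have "?h `` {?r} \<in> ?N" using Cons.IH[OF w vs] by simp
  ultimately have "?h `` {?g} \<otimes>\<^bsub>fundamental_group QA IA z\<^esub> ?h `` {?r} \<in> ?N" by (rule subgroup.m_closed[OF N.subgroup_axioms])
  \<comment> \<open>Group multiplication runs through its right factor first, so the walks are
    concatenated in the opposite order.\<close>
  then have "?h `` {?r @ ?g} \<in> ?N" unfolding fundamental_group_def walk_group_mult[OF wf(1) g r] .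
  moreover have "?h `` {?r @ ?g} = ?h `` {v @ (s # w) @ walk_inv (walk_subst f (s # w)) @ walk_inv v}"
  proof -
    let ?l = "v @ [s] @ w @ walk_inv (walk_subst f w)" and ?q = "walk_inv p @ walk_inv v"
    have l: "walk QA z ?l x'" by (rule app[OF v app[OF step app[OF w inv_subst]]])
    note q = inv_pv
    \<comment> \<open>At the junction of \<open>?r\<close> and \<open>?g\<close> the inverse of
      \<open>v @ [s]\<close> meets \<open>v @ [s]\<close> and cancels.\<close>
    have c: "homotopic QA (minimally_related IA) z
        (?l @ walk_inv (v @ [s]) @ walk_inv (walk_inv (v @ [s])) @ ?q) (?l @ ?q) z"
      by (rule homotopic_cancel_middle[OF wf(1) l inv[OF vs] q])
    have "walk_subst f (s # w) = p @ walk_subst f w" by (simp add: p_def s)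
    then show ?thesis
      using c app[OF r g] app[OF l q]
      by (subst homotopy_class_eq_iff[OF wf(1)]) (simp_all add: walk_inv_simps)
  qed
  ultimately show ?case by simp
qed

text \<open>The first isomorphism theorem, applied to the homomorphism induced by substitution. Both
  groups are based at \<open>z\<close>.\<close>

lemma fundamental_group_Mod_iso_relative:
  assumes sub: "subgraph QB QA" and I: "minimally_related IA \<subseteq> Id"
    and T: "subgraph T QA" "quiver_tree T" "verts T = verts QA"
    and forest: "\<And>a. a \<in> arcs QB \<Longrightarrow> \<exists>p. walk T (tail QB a) p (head QB a) \<and> walk QB (tail QB a) p (head QB a)"
    and z: "z \<in> verts QA"
  shows "fundamental_group QA IA z Mod subquiver_subgroup QA IA QB z
    \<cong> quiver_fundamental_group (relative_quiver QA QB T) z"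
proof -
  define R where "R = relative_quiver QA QB T"
  let ?S = "minimally_related IA" and ?N = "subquiver_subgroup QA IA QB z"
  let ?G = "walk_group QA ?S z" and ?H = "walk_group R {} z"
  have wf: "wf_digraph QA" "wf_digraph QB" "wf_digraph T" using sub T(1) by (auto simp: subgraph_def)
  have th: "tail QB = tail QA" "head QB = head QA" "tail T = tail QA" "head T = head QA"
    "tail R = tail QA" "head R = head QA" "verts R = verts QA" "arcs R = (arcs QA - arcs QB) \<union> arcs T"
    using sub T(1) by (auto simp: subgraph_def compatible_def R_def relative_quiver_def)
  have subTR: "subgraph T R" and subR: "subgraph R QA" and wfR: "wf_digraph R"
    using sub T(1,3) wf by (auto simp: subgraph_def compatible_def th wf_digraph_def)
  \<comment> \<open>An arrow outside the relative quiver belongs to \<open>QB\<close>. Its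
    substitute must lie in \<open>T\<close>, so that the generators of the subgroup die, and in
    \<open>QB\<close>, so that the substitution changes walks only modulo the subgroup.\<close>
  define f where "f a = (if a \<in> arcs R then [(a, True)]
    else SOME p. walk T (tail QB a) p (head QB a) \<and> walk QB (tail QB a) p (head QB a))" for a
  have f_R: "f a = [(a, True)]" if "a \<in> arcs R" for a using that by (simp add: f_def)
  have f_B: "walk T (tail QB a) (f a) (head QB a) \<and> walk QB (tail QB a) (f a) (head QB a)"
    if "a \<in> arcs QB" "a \<notin> arcs R" for a
    using someI_ex[OF forest[OF that(1)]] that(2) by (simp add: f_def)
  \<comment> \<open>An arrow of \<open>QB\<close> that remains in the relative quiver is an arrow of
    \<open>T\<close>, so all of \<open>QB\<close> is sent into \<open>T\<close>.\<close>
  have f_T: "walk T (tail QB a) (f a) (head QB a)" if "a \<in> arcs QB" for a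
    using f_B[OF that] f_R[of a] walk_arc[OF wf(3), of a] that by (cases "a \<in> arcs R") (auto simp: th)
  have f_or: "f a = [(a, True)] \<or> a \<in> arcs QB \<and> walk QB (tail QB a) (f a) (head QB a)"
    if "a \<in> arcs QA" for a
    using that f_R[of a] f_B[of a] by (cases "a \<in> arcs R") (auto simp: th)
  have f_walk: "walk R (tail QA a) (f a) (head QA a)" if "a \<in> arcs QA" for a
    using that f_R[of a] f_T[of a] walk_arc[OF wfR, of a] walk_subgraph[OF subTR]
    by (cases "a \<in> arcs R") (auto simp: th)
  have verts: "verts QA \<subseteq> verts R" "verts QB \<subseteq> verts T" using sub T(3) by (auto simp: th subgraph_def)
  note subst_walk = walk_subst_walk[OF wf(1) wfR verts(1) f_walk]
  let ?g = "walk_subst f"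
  have hom: "homotopic R {} x (?g v) (?g w) y" if "homotopic QA ?S x v w y" for x v w y
    using that walk_subst_homotopic[OF wf(1) wfR verts(1) f_walk] homotopic_trivial_relations[OF wf(1) I] by blast
  let ?\<phi> = "walk_group_map ?g R {} z"
  have \<phi>_hom: "?\<phi> \<in> Group.hom ?G ?H"
    by (rule walk_group_map_hom[OF wf(1) wfR hom])
      (auto intro!: homotopic_refl walk_append[OF wfR] subst_walk)
  have zR: "z \<in> verts R" using z by (simp add: th)
  interpret G: group ?G by (rule group_walk_group[OF wf(1) z])
  interpret H: group ?H by (rule group_walk_group[OF wfR zR])
  interpret \<phi>: group_hom ?G ?H ?\<phi> by unfold_locales (rule \<phi>_hom)
  have cls: "?\<phi> (homotopy QA ?S z `` {w}) = homotopy R {} z `` {?g w}" if "walk QA z w z" for w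
    by (rule walk_group_map_class[OF wf(1) wfR hom that])
  \<comment> \<open>Walks of the relative quiver serve as their own preimages, which gives
    surjectivity.\<close>
  have fix_R: "?g w = w" if "walk R x w y" for x w y
    using that
  proof (induction w arbitrary: x)
    case (Cons s w)
    then show ?case
      by (cases s) (auto simp: walk_Cons[OF wfR] arcs_double f_R walk_inv_simps)
  qed simp
  have "?\<phi> ` carrier ?G = carrier ?H"
  proof
    show "?\<phi> ` carrier ?G \<subseteq> carrier ?H" using \<phi>.hom_closed by blast
    show "carrier ?H \<subseteq> ?\<phi> ` carrier ?G"
    proof
      fix V assume "V \<in> carrier ?H"
      then obtain w where w: "V = homotopy R {} z `` {w}" "walk R z w z" by (auto simp: walk_group_carrier)
      then have "walk QA z w z" "V = ?\<phi> (homotopy QA ?S z `` {w})"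
        using walk_subgraph[OF subR] by (auto simp: cls fix_R)
      then show "V \<in> ?\<phi> ` carrier ?G" by (auto simp: walk_group_carrier)
    qed
  qed
  moreover have "kernel ?G ?H ?\<phi> = ?N"
  proof
    show "?N \<subseteq> kernel ?G ?H ?\<phi>"
      unfolding subquiver_subgroup_def fundamental_group_def
    proof (rule G.generate_subgroup_incl[OF _ \<phi>.subgroup_kernel], clarify)
      fix u u' v x y assume u: "walk QB x u y" "walk QB x u' y" and v: "walk QA z v x"
      let ?w = "v @ u @ walk_inv u' @ walk_inv v"
      have w: "walk QA z ?w z"
        by (intro walk_append[OF wf(1) v] walk_append[OF wf(1) walk_subgraph[OF sub u(1)]]
          walk_append[OF wf(1) walk_inv_walk[OF wf(1) walk_subgraph[OF sub u(2)]]] walk_inv_walk[OF wf(1) v])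
      \<comment> \<open>Parallel walks of \<open>QB\<close> become parallel walks in a tree, hence
        homotopic, so every generator maps to the identity.\<close>
      have gT: "walk T x (?g u) y" "walk T x (?g u') y"
        using u walk_subst_walk[OF wf(2,3) verts(2) f_T] by blast+
      then have gR: "walk R x (?g u) y" "walk R x (?g u') y" using walk_subgraph[OF subTR] by blast+
      have gv: "walk R z (?g v) x" by (rule subst_walk[OF _ v])
      have "homotopic R {} x (?g u) (?g u') y"
        by (rule homotopic_subgraph[OF subTR tree_parallel_walks_homotopic[OF wf(3) T(2) gT]])
      then have "homotopic R {} z (?g v @ ?g u @ walk_inv (?g u') @ walk_inv (?g v))
          (?g v @ ?g u' @ walk_inv (?g u') @ walk_inv (?g v)) z"
        using gR gv by (intro homotopic_concat[where y = x] homotopic_concat[where y = y] homotopic_refl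
          walk_inv_walk[OF wfR])
      moreover have "homotopic R {} z ((?g v @ ?g u') @ walk_inv (?g v @ ?g u')) [] z"
        by (rule homotopic_cancel[OF wfR walk_append[OF wfR gv gR(2)]])
      ultimately have "homotopic R {} z (?g ?w) [] z"
        by (auto simp: walk_subst_inv walk_inv_simps intro: homotopic_trans)
      then have "homotopy R {} z `` {?g ?w} = homotopy R {} z `` {[]}"
        by (subst homotopy_class_eq_iff[OF wfR subst_walk[OF _ w] walk_Nil[OF zR]])
      then show "homotopy QA ?S z `` {?w} \<in> kernel ?G ?H ?\<phi>"
        using w cls[OF w] unfolding kernel_def walk_group_one by (auto simp: walk_group_carrier)
    qed
    show "kernel ?G ?H ?\<phi> \<subseteq> ?N"
    proof
      fix U assume "U \<in> kernel ?G ?H ?\<phi>"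
      then obtain w where w: "U = homotopy QA ?S z `` {w}" "walk QA z w z"
        and "?\<phi> U = one ?H" by (auto simp: kernel_def walk_group_carrier)
      then have "homotopic R {} z (?g w) [] z"
        using homotopy_class_eq_iff[OF wfR subst_walk[OF _ w(2)] walk_Nil[OF zR], of "{}"]
        by (simp add: cls walk_group_one)
      \<comment> \<open>A null-homotopy in the relative quiver is also one in \<open>QA\<close>.
        Thus \<open>w\<close> is homotopic there to \<open>w @ walk_inv (?g w)\<close>, whose class
        lies in the subgroup by the telescoping lemma with empty \<open>v\<close>.\<close>
      then have triv: "homotopic QA ?S z (?g w) [] z"
        using homotopic_subgraph[OF subR] homotopic_trivial_relations[OF wf(1) I] by blast
      have gw: "walk QA z (?g w) z" using walk_subgraph[OF subR subst_walk[OF _ w(2)]] by blast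
      have igw: "walk QA z (walk_inv (?g w)) z" by (rule walk_inv_walk[OF wf(1) gw])
      have "homotopic QA ?S z (?g w @ walk_inv (?g w)) ([] @ walk_inv (?g w)) z"
        by (rule homotopic_concat[OF triv homotopic_refl[OF igw]])
      then have "homotopic QA ?S z (walk_inv (?g w)) [] z"
        using homotopic_cancel[OF wf(1) gw] by (auto intro: homotopic_trans homotopic_sym)
      then have "homotopic QA ?S z (w @ walk_inv (?g w)) (w @ []) z"
        by (rule homotopic_concat[OF homotopic_refl[OF w(2)]])
      then have "U = homotopy QA ?S z `` {w @ walk_inv (?g w)}"
        using w walk_append[OF wf(1) w(2) igw] by (simp add: homotopy_class_eq_iff[OF wf(1)] homotopic_sym)
      then show "U \<in> ?N"
        using walk_subst_class_in_subquiver_subgroup[OF sub f_or w(2) walk_Nil[OF z], of IA]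
        by (simp add: walk_inv_simps)
    qed
  qed
  ultimately show ?thesis
    using \<phi>.FactGroup_iso by (simp add: fundamental_group_def quiver_fundamental_group_def R_def)
qed

section \<open>Extended maximal trees and the conclusion\<close>

lemma extended_maximal_tree_spanning:
  assumes "Digraph_Component.connected QA" "extended_maximal_tree QA QB T"
  shows "subgraph T QA" "quiver_tree T" "verts T = verts QA"
  using assms maximal_tree_spanning[of QA T]
  by (auto simp: extended_maximal_tree_def pre_digraph.max_subgraph_def)

text \<open>The maximal tree \<open>F\<close> of the component containing \<open>a\<close> spans
  that component, so it joins the ends of \<open>a\<close>; and \<open>F\<close> lies in both
  \<open>T\<close> and \<open>QB\<close>.\<close>

lemma extended_maximal_tree_forest:
  assumes wf: "wf_digraph QB" and T: "extended_maximal_tree QA QB T" and a: "a \<in> arcs QB"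
  shows "\<exists>p. walk T (tail QB a) p (head QB a) \<and> walk QB (tail QB a) p (head QB a)"
proof -
  obtain C where C: "quiver_component C QB" "tail QB a \<in> verts C" "head QB a \<in> verts C"
    using walk_in_quiver_component[OF wf walk_arc[OF wf a]] by blast
  then obtain F where F: "maximal_tree F C" "subgraph F T"
    using T by (auto simp: extended_maximal_tree_def)
  have sub: "subgraph F C" "subgraph C QB" and tree: "quiver_tree F"
    and conn: "Digraph_Component.connected C"
    using C(1) F(1) by (auto simp: pre_digraph.max_subgraph_def)
  have "wf_digraph F" using sub(1) by (simp add: subgraph_def)
  then have "\<exists>p. walk F (tail QB a) p (head QB a)"
    using tree C(2,3) maximal_tree_spanning[OF conn F(1)]
    unfolding quiver_tree_def by (auto simp: connected_iff_walk)
  then show ?thesis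
    using walk_subgraph[OF F(2)] walk_subgraph[OF sub(1)] walk_subgraph[OF sub(2)] by blast
qed

theorem theorem6p17:
  fixes QA QB T :: "('v, 'a) pre_digraph"
    and IA IB :: "(('v, 'a) qpath \<Rightarrow>\<^sub>0 'k::alg_closed_field) set"
    and z x :: 'v
  assumes "monomial_presentation QA IA"
    and "connected_algebra (bound_quiver_algebra QA IA)"
    and "monomial_presentation QB IB"
    and "induced_subalgebra QB IB QA IA"
    and "extended_maximal_tree QA QB T"
    and "z \<in> verts QA" and "x \<in> verts QA"
  shows "fundamental_group QA IA z Mod subquiver_subgroup QA IA QB z
           \<cong> quiver_fundamental_group (relative_quiver QA QB T) x"
proof -
  have sub: "subgraph QB QA" using assms(4) by (simp add: induced_subalgebra_def spanning_def)
  then have wf: "wf_digraph QA" "wf_digraph QB" by (auto simp: subgraph_def)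
  have conn: "Digraph_Component.connected QA"
    unfolding connected_iff_walk[OF wf(1)]
    using connected_algebra_walk[OF assms(1,2)] assms(6) by blast
  note T = extended_maximal_tree_spanning[OF conn assms(5)]
  let ?R = "relative_quiver QA QB T"
  have "fundamental_group QA IA z Mod subquiver_subgroup QA IA QB z \<cong> quiver_fundamental_group ?R z"
    using extended_maximal_tree_forest[OF wf(2) assms(5)]
    by (intro fundamental_group_Mod_iso_relative[OF sub monomial_minimally_related[OF assms(1)] T _ assms(6)])
  \<comment> \<open>The spanning tree \<open>T\<close> lies in the relative quiver and provides a
    walk between the two base points.\<close>
  moreover have "quiver_fundamental_group ?R z \<cong> quiver_fundamental_group ?R x"
  proof -
    have "subgraph T ?R" "wf_digraph ?R"
      using T(1,3) wf by (auto simp: subgraph_def compatible_def relative_quiver_def wf_digraph_def)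
    moreover have "\<exists>p. walk T z p x"
      using T(1-3) assms(6,7) by (auto simp: quiver_tree_def subgraph_def connected_iff_walk)
    ultimately show ?thesis
      unfolding quiver_fundamental_group_def using walk_group_basepoint_iso walk_subgraph by metis
  qed
  ultimately show ?thesis by (rule iso_trans)
qed

end
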